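(* Let $N\ge5$ and, for $0\le\lambda\le\left(\frac{N-1}{2}\right)^2$, let $h_N(\lambda):=\frac{\sqrt{(N-1)^2-4\lambda}+1}{2}$. For all $0\le\lambda\le\left(\frac{N-1}{2}\right)^2$ and all $u\in C_c^\infty(\mathbb{H}^N\setminus\{x_0\})$, $$\left(\int_{\mathbb{H}^N}\left(|\Delta_{\mathbb{H}^N}u|^2-\lambda|\nabla_{\mathbb{H}^N}u|^2\right)dv_{\mathbb{H}^N}\right)\left(\int_{\mathbb{H}^N}r^2|\nabla_{\mathbb{H}^N}u|^2\,dv_{\mathbb{H}^N}\right)\ge h_N^2(\lambda)\left(\int_{\mathbb{H}^N}|\nabla_{\mathbb{H}^N}u|^2\,dv_{\mathbb{H}^N}\right)^2.$$ In particular, for $\lambda=0$, $$\left(\int_{\mathbb{H}^N}|\Delta_{\mathbb{H}^N}u|^2\,dv_{\mathbb{H}^N}\right)\left(\int_{\mathbb{H}^N}r^2|\nabla_{\mathbb{H}^N}u|^2\,dv_{\mathbb{H}^N}\right)\ge\frac{N^2}{4}\left(\int_{\mathbb{H}^N}|\nabla_{\mathbb{H}^N}u|^2\,dv_{\mathbb{H}^N}\right)^2$$ for all $u\in C_c^\infty(\mathbb{H}^N\setminus\{x_0\})$.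
   Context: $\mathbb{H}^N$ is the $N$-dimensional hyperbolic space (constant curvature $-1$) with Riemannian volume $dv_{\mathbb{H}^N}$, Laplace-Beltrami operator $\Delta_{\mathbb{H}^N}$ and Riemannian gradient $\nabla_{\mathbb{H}^N}$; $x_0\in\mathbb{H}^N$ is a fixed pole and $r=d(x,x_0)$ is the geodesic distance from $x_0$. Functions are real-valued. *)

theory Defs
  imports "HOL-Analysis.Analysis"
begin

text \<open>
  A Riemannian metric on an open set \<open>M\<close> of \<open>\<real>\<^sup>n\<close>, in its standard global chart, is a function
  \<open>g\<close> with \<open>g x v w\<close> the inner product of the tangent vectors \<open>v\<close> and \<open>w\<close> at \<open>x\<close>.
  It carries no information outside \<open>M\<close>.
\<close>

type_synonym 'n riem_metric = "real ^ 'n \<Rightarrow> real ^ 'n \<Rightarrow> real ^ 'n \<Rightarrow> real"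

definition riem_grad :: "'n::finite riem_metric \<Rightarrow> (real ^ 'n \<Rightarrow> real) \<Rightarrow> real ^ 'n \<Rightarrow> real ^ 'n" where
  "riem_grad g f x = (THE w. \<forall>v. g x w v = frechet_derivative f (at x) v)"

definition vol_density :: "'n::finite riem_metric \<Rightarrow> real ^ 'n \<Rightarrow> real" where
  "vol_density g x = sqrt (det (\<chi> i j. g x (axis i 1) (axis j 1)))"

definition riem_volume :: "'n::finite riem_metric \<Rightarrow> (real ^ 'n) set \<Rightarrow> (real ^ 'n) measure" where
  "riem_volume g M = density (restrict_space lborel M) (\<lambda>x. ennreal (vol_density g x))"

definition riem_div :: "'n::finite riem_metric \<Rightarrow> (real ^ 'n \<Rightarrow> real ^ 'n) \<Rightarrow> real ^ 'n \<Rightarrow> real" where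
  "riem_div g X x =
     (\<Sum>i\<in>UNIV. frechet_derivative (\<lambda>y. vol_density g y * X y $ i) (at x) (axis i 1)) / vol_density g x"

definition laplace_beltrami :: "'n::finite riem_metric \<Rightarrow> (real ^ 'n \<Rightarrow> real) \<Rightarrow> real ^ 'n \<Rightarrow> real" where
  "laplace_beltrami g f = riem_div g (riem_grad g f)"

text \<open>
  The infimum of the lengths of the piecewise \<open>C\<^sup>1\<close> curves in \<open>M\<close> from \<open>x\<close> to \<open>y\<close>.
  The derivative of a \<^const>\<open>valid_path\<close> may be unbounded near the exceptional points, so that
  such a curve can have infinite length; \<^const>\<open>has_integral\<close> (rather than \<^const>\<open>integral\<close>,
  which would yield 0) discards these curves.
\<close>

definition riem_dist :: "'n::finite riem_metric \<Rightarrow> (real ^ 'n) set \<Rightarrow> real ^ 'n \<Rightarrow> real ^ 'n \<Rightarrow> real" where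
  "riem_dist g M x y = Inf {L. \<exists>\<gamma>. valid_path \<gamma> \<and> path_image \<gamma> \<subseteq> M \<and> pathstart \<gamma> = x \<and> pathfinish \<gamma> = y \<and>
     ((\<lambda>t. sqrt (g (\<gamma> t) (vector_derivative \<gamma> (at t)) (vector_derivative \<gamma> (at t)))) has_integral L) {0..1}}"

primrec Ck_on :: "nat \<Rightarrow> 'a::real_normed_vector set \<Rightarrow> ('a \<Rightarrow> real) \<Rightarrow> bool" where
  "Ck_on 0 S f = continuous_on S f"
| "Ck_on (Suc k) S f =
     ((\<forall>x\<in>S. f differentiable (at x)) \<and> (\<forall>v. Ck_on k S (\<lambda>x. frechet_derivative f (at x) v)))"

text \<open>
  \<open>C\<^sub>c\<^sup>\<infinity>(\<Omega>)\<close> for an open set \<open>\<Omega>\<close>, its members being extended by zero to the whole space.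
\<close>

definition test_functions :: "'a::real_normed_vector set \<Rightarrow> ('a \<Rightarrow> real) set" where
  "test_functions \<Omega> =
     {u. (\<forall>k. Ck_on k UNIV u) \<and> compact (closure {x. u x \<noteq> 0}) \<and> closure {x. u x \<noteq> 0} \<subseteq> \<Omega>}"

text \<open>
  Hyperbolic space of curvature \<open>-1\<close> in the Poincare ball model.
\<close>

definition hyp_space :: "(real ^ 'n::finite) set" where
  "hyp_space = ball 0 1"

definition hyp_metric :: "'n::finite riem_metric" where
  "hyp_metric x v w = (2 / (1 - (norm x)\<^sup>2))\<^sup>2 * (v \<bullet> w)"

definition hyp_volume :: "(real ^ 'n::finite) measure" where
  "hyp_volume = riem_volume hyp_metric hyp_space"

definition hyp_dist :: "real ^ 'n::finite \<Rightarrow> real ^ 'n \<Rightarrow> real" where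
  "hyp_dist = riem_dist hyp_metric hyp_space"

definition hyp_laplace :: "(real ^ 'n::finite \<Rightarrow> real) \<Rightarrow> real ^ 'n \<Rightarrow> real" where
  "hyp_laplace = laplace_beltrami hyp_metric"

text \<open>The squared Riemannian length of the Riemannian gradient.\<close>

definition hyp_grad_sq :: "(real ^ 'n::finite \<Rightarrow> real) \<Rightarrow> real ^ 'n \<Rightarrow> real" where
  "hyp_grad_sq u x = hyp_metric x (riem_grad hyp_metric u x) (riem_grad hyp_metric u x)"

definition h_const :: "nat \<Rightarrow> real \<Rightarrow> real" where
  "h_const N lam = (sqrt ((real N - 1)\<^sup>2 - 4 * lam) + 1) / 2"

lemma hyp_riem_grad:
  fixes x :: "real ^ 'n::finite"
  assumes "x \<in> hyp_space" "u differentiable (at x)"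
  shows "riem_grad hyp_metric u x =
    ((1 - (norm x)\<^sup>2) / 2)\<^sup>2 *\<^sub>R (\<chi> i. frechet_derivative u (at x) (axis i 1))"
proof -
  let ?c = "(2 / (1 - (norm x)\<^sup>2))\<^sup>2" and ?d = "((1 - (norm x)\<^sup>2) / 2)\<^sup>2"
  let ?D = "frechet_derivative u (at x)"
  let ?e = "(\<chi> i. ?D (axis i 1)) :: real ^ 'n"
  have "norm x < 1" using assms(1) by (simp add: hyp_space_def)
  then have "(norm x)\<^sup>2 < 1" by (simp add: power_less_one_iff)
  then have "2 / (1 - (norm x)\<^sup>2) * ((1 - (norm x)\<^sup>2) / 2) = 1" by simp
  then have cd: "?c * ?d = 1" by (metis power_mult_distrib power_one)
  have lin: "linear ?D" using assms(2) by (rule linear_frechet_derivative)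
  have D: "?D v = ?e \<bullet> v" for v
  proof -
    have "?D v = ?D (\<Sum>i\<in>UNIV. v $ i *\<^sub>R axis i 1)"
      using basis_expansion[of v] by (simp add: scalar_mult_eq_scaleR)
    also have "\<dots> = (\<Sum>i\<in>UNIV. v $ i * ?D (axis i 1))"
      by (simp add: linear_sum[OF lin] linear_cmul[OF lin])
    finally have "?D v = (\<Sum>i\<in>UNIV. v $ i * ?D (axis i 1))" .
    then show ?thesis by (simp add: inner_vec_def mult.commute)
  qed
  show ?thesis unfolding riem_grad_def
  proof (rule the_equality)
    have "hyp_metric x (?d *\<^sub>R ?e) v = ?D v" for v
    proof -
      have "hyp_metric x (?d *\<^sub>R ?e) v = (?c * ?d) * (?e \<bullet> v)"
        unfolding hyp_metric_def inner_scaleR_left by (rule mult.assoc[symmetric])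
      also have "\<dots> = ?D v" unfolding cd mult_1 by (rule D[symmetric])
      finally show ?thesis .
    qed
    then show "\<forall>v. hyp_metric x (?d *\<^sub>R ?e) v = ?D v" ..
    fix w assume w: "\<forall>v. hyp_metric x w v = ?D v"
    have "?c * (w \<bullet> v) = ?e \<bullet> v" for v
      using w[rule_format, of v] D[of v] unfolding hyp_metric_def by (rule trans)
    then have "(?c *\<^sub>R w) \<bullet> v = ?e \<bullet> v" for v by simp
    then have "?c *\<^sub>R w = ?e" using vector_eq_rdot by blast
    then have "?d *\<^sub>R ?e = ?d *\<^sub>R (?c *\<^sub>R w)" by (rule arg_cong[OF sym])
    also have "\<dots> = (?c * ?d) *\<^sub>R w" by (simp only: scaleR_scaleR mult.commute)
    finally show "w = ?d *\<^sub>R ?e" unfolding cd by simp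
  qed
qed

lemma hyp_vol_density:
  fixes x :: "real ^ 'n::finite"
  assumes "x \<in> hyp_space"
  shows "vol_density hyp_metric x = (2 / (1 - (norm x)\<^sup>2)) ^ CARD('n)"
proof -
  have "norm x < 1" using assms by (simp add: hyp_space_def)
  then have p: "0 < 2 / (1 - (norm x)\<^sup>2)" by (simp add: power_less_one_iff)
  have "det (\<chi> i j. hyp_metric x (axis i 1) (axis j 1) :: real ^ 'n ^ 'n)
      = (\<Prod>i\<in>(UNIV :: 'n set). (2 / (1 - (norm x)\<^sup>2))\<^sup>2)"
    by (subst det_diagonal) (auto simp: hyp_metric_def inner_axis_axis)
  also have "\<dots> = ((2 / (1 - (norm x)\<^sup>2)) ^ CARD('n))\<^sup>2"
    by (simp add: power_mult[symmetric] mult.commute)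
  finally show ?thesis unfolding vol_density_def using p by (simp only: real_sqrt_abs) simp
qed

end

theory Submission
  imports Defs
begin

text \<open>
  Put \<open>\<nu> = (N - 1) / 2\<close> and let \<open>r\<close> be the distance to the pole. Optimising over \<open>t\<close>, and then over
  \<open>\<lambda> = \<nu>\<^sup>2 - \<mu>\<^sup>2\<close>, the claim amounts to
  \<open>\<integral> (\<Delta>u)\<^sup>2 + t\<^sup>2 r\<^sup>2 |\<nabla>u|\<^sup>2 \<ge> B(t) \<integral> |\<nabla>u|\<^sup>2\<close> for all \<open>t > 0\<close>, where \<open>B(t)\<close> is the maximum of
  \<open>(2\<mu> + 1) t + \<nu>\<^sup>2 - \<mu>\<^sup>2\<close> over \<open>0 \<le> \<mu> \<le> \<nu>\<close>.
  This follows from a single square, \<open>0 \<le> \<integral> (\<Delta>u + f u\<^sub>r + g u)\<^sup>2\<close> with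
  \<open>f = t r + K\<close>, \<open>g = (\<nu> coth r + K) f + \<nu> t\<close> and \<open>K = max 0 (\<nu> - t)\<close>. Integrating the mixed terms by
  parts (the one with \<open>\<Delta>u u\<^sub>r\<close> by Pohozaev's identity, as \<open>sinh r \<partial>\<^sub>r\<close> is a conformal field) leaves
  weighted integrals of \<open>u\<^sub>r\<^sup>2\<close>, of the squared tangential gradient and of \<open>u\<^sup>2\<close>. The weight of \<open>u\<^sub>r\<^sup>2\<close>
  is exactly the one required, that of the tangential part is at least as good, and that of \<open>u\<^sup>2\<close>
  is nonpositive.
\<close>

section \<open>The divergence theorem for compactly supported fields\<close>

text \<open>The complement of \<open>S\<close> is an open neighbourhood of \<open>x\<close> on which
  \<open>f\<close> is the zero function, so uniqueness of the derivative applies.\<close>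

lemma has_derivative_eq_zero_off:
  fixes f :: "'a::euclidean_space \<Rightarrow> 'b::real_normed_vector"
  assumes "(f has_derivative D) (at x)" "closed S" "x \<notin> S" "\<And>y. y \<notin> S \<Longrightarrow> f y = 0"
  shows "D = (\<lambda>h. 0)"
proof -
  have "((\<lambda>y. 0) has_derivative D) (at x)"
    by (rule has_derivative_transform_within_open[OF assms(1), of "- S"])
       (use assms in \<open>auto simp: open_Compl\<close>)
  then show ?thesis
    by (metis has_derivative_const has_derivative_unique)
qed

text \<open>\<open>\<Omega>\<close> and the complement of \<open>S\<close> are open, cover the
  space, and \<open>f\<close> is continuous on each. This serves weights that are singular at the
  pole or at the boundary of the ball.\<close>

lemma continuous_on_UNIV_zero_off:
  fixes f :: "'a::topological_space \<Rightarrow> 'b::real_normed_vector"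
  assumes "continuous_on \<Omega> f" "open \<Omega>" "closed S" "S \<subseteq> \<Omega>" "\<And>y. y \<notin> S \<Longrightarrow> f y = 0"
  shows "continuous_on UNIV f"
proof -
  have "continuous_on (- S) f"
    using continuous_on_cong[of "- S" "- S" f "\<lambda>_. 0"] assms(5) by auto
  then have "continuous_on (\<Omega> \<union> - S) f"
    using assms by (intro continuous_on_open_Un) (auto simp: open_Compl)
  moreover have "\<Omega> \<union> - S = UNIV" using assms(4) by auto
  ultimately show ?thesis by simp
qed

lemma integrable_continuous_compact_support:
  fixes f :: "'a::euclidean_space \<Rightarrow> real"
  assumes "continuous_on UNIV f" "compact S" "\<And>y. y \<notin> S \<Longrightarrow> f y = 0"
  shows "integrable lborel f"
proof -
  have "integrable lborel (\<lambda>x. indicator S x *\<^sub>R f x)"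
    using assms(1,2) continuous_on_subset by (intro borel_integrable_compact) auto
  moreover have "(\<lambda>x. indicator S x *\<^sub>R f x) = f"
    using assms(3) by (auto simp: indicator_def fun_eq_iff)
  ultimately show ?thesis by simp
qed

lemma integral_lborel_translation:
  fixes f :: "'a::euclidean_space \<Rightarrow> real"
  assumes "f \<in> borel_measurable borel"
  shows "(\<integral>x. f (x + a) \<partial>lborel) = (\<integral>x. f x \<partial>lborel)"
proof -
  have "(\<integral>x. f x \<partial>lborel) = (\<integral>x. f x \<partial>(distr lborel borel ((+) a)))"
    by (simp add: lborel_distr_plus)
  also have "\<dots> = (\<integral>x. f (x + a) \<partial>lborel)"
    using assms by (subst integral_distr) (auto simp: add.commute)
  finally show ?thesis by simp
qed

text \<open>The difference quotients integrate to zero by translation invariance, and converge dominatedly.\<close>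
lemma integral_directional_derivative_eq_0:
  fixes \<phi> :: "'a::euclidean_space \<Rightarrow> real"
  assumes d: "\<And>x. (\<phi> has_derivative \<phi>' x) (at x)"
    and c: "continuous_on UNIV (\<lambda>x. \<phi>' x e)"
    and S: "compact S" "\<And>x. x \<notin> S \<Longrightarrow> \<phi> x = 0"
  shows "has_bochner_integral lborel (\<lambda>x. \<phi>' x e) 0"
proof -
  have z: "\<phi>' x e = 0" if "x \<notin> S" for x
    using has_derivative_eq_zero_off[OF d compact_imp_closed[OF S(1)] that S(2)] by simp
  have int: "integrable lborel (\<lambda>x. \<phi>' x e)"
    using integrable_continuous_compact_support[OF c S(1)] z by simp
  have cont: "continuous_on UNIV \<phi>"
    using d has_derivative_continuous continuous_at_imp_continuous_on by blast
  have int\<phi>: "integrable lborel \<phi>"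
    using integrable_continuous_compact_support[OF cont S] by simp
  have "bounded ((\<lambda>x. \<phi>' x e) ` S)"
    using c S(1) by (blast intro: compact_imp_bounded compact_continuous_image continuous_on_subset)
  then obtain B0 where B0: "\<And>x. x \<in> S \<Longrightarrow> \<bar>\<phi>' x e\<bar> \<le> B0"
    by (auto simp: bounded_iff)
  \<comment> \<open>If \<open>S\<close> is empty, \<open>B0\<close> may be negative; the maximum
    gives a bound valid everywhere.\<close>
  define B where "B = max B0 0"
  have B: "\<bar>\<phi>' x e\<bar> \<le> B" for x
    using B0[of x] z[of x] by (cases "x \<in> S") (auto simp: B_def)
  obtain R0 where R0: "\<And>x. x \<in> S \<Longrightarrow> norm x \<le> R0"
    using compact_imp_bounded[OF S(1)] by (auto simp: bounded_iff)
  define h where "h n = 1 / real (Suc n)" for n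
  have h: "0 < h n" "h n \<le> 1" for n by (auto simp: h_def)
  define q where "q n x = (\<phi> (x + h n *\<^sub>R e) - \<phi> x) / h n" for n x
  \<comment> \<open>Since \<open>0 < h n \<le> 1\<close>, this one ball contains \<open>S\<close>
    and all the translates of \<open>S\<close> by \<open>- h n *\<^sub>R e\<close>, hence the
    supports of all \<open>q n\<close>.\<close>
  define T where "T = cball (0::'a) (R0 + norm e)"
  \<comment> \<open>The mean value theorem bounds every difference quotient by the bound of the
    derivative, uniformly in \<open>n\<close>.\<close>
  have qb: "\<bar>q n x\<bar> \<le> B" for n x
  proof -
    have "\<bar>\<phi> (x + h n *\<^sub>R e) - \<phi> (x + 0 *\<^sub>R e)\<bar> \<le> B * h n"
    proof -
      have "((\<lambda>s. \<phi> (x + s *\<^sub>R e)) has_real_derivative \<phi>' (x + s *\<^sub>R e) e) (at s)" for s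
      proof -
        have "((\<lambda>s. \<phi> (x + s *\<^sub>R e)) has_derivative (\<lambda>k. \<phi>' (x + s *\<^sub>R e) (k *\<^sub>R e))) (at s)"
          by (rule has_derivative_compose[OF _ d]) (auto intro!: derivative_eq_intros)
        moreover have "\<phi>' (x + s *\<^sub>R e) (k *\<^sub>R e) = \<phi>' (x + s *\<^sub>R e) e * k" for k
          using has_derivative_linear[OF d] by (simp add: linear_cmul)
        ultimately show ?thesis by (simp add: has_field_derivative_def)
      qed
      from MVT2[OF h(1)[of n] this]
      obtain s where "\<phi> (x + h n *\<^sub>R e) - \<phi> (x + 0 *\<^sub>R e) = h n * \<phi>' (x + s *\<^sub>R e) e"
        by auto
      then show ?thesis using B[of "x + s *\<^sub>R e"] h(1)[of n] by (simp add: abs_mult mult.commute)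
    qed
    then show ?thesis using h(1)[of n] by (simp add: q_def divide_simps)
  qed
  have qz: "q n x = 0" if "x \<notin> T" for n x
  proof -
    from that have "norm x > R0 + norm e" by (simp add: T_def)
    moreover have "R0 \<le> R0 + norm e" by simp
    ultimately have 1: "x \<notin> S" using R0[of x] by linarith
    have "norm (h n *\<^sub>R e) \<le> norm e" using h[of n] by (simp add: mult_left_le_one_le)
    then have "norm (x + h n *\<^sub>R e) > R0"
      using that norm_triangle_ineq4[of "x + h n *\<^sub>R e" "h n *\<^sub>R e"] by (auto simp: T_def)
    then have "x + h n *\<^sub>R e \<notin> S" using R0 by force
    then show ?thesis using 1 S(2) by (simp add: q_def)
  qed
  have qm: "q n \<in> borel_measurable lborel" for n
  proof -
    have "continuous_on UNIV (q n)"
      unfolding q_def using h(1)[of n]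
      by (intro continuous_intros continuous_on_compose2[OF cont]) auto
    then show ?thesis by (simp add: borel_measurable_continuous_onI)
  qed
  have q0: "(\<integral>x. q n x \<partial>lborel) = 0" for n
  proof -
    have "continuous_on UNIV (\<lambda>x. \<phi> (x + h n *\<^sub>R e))"
      by (intro continuous_intros continuous_on_compose2[OF cont]) auto
    moreover have "\<phi> (x + h n *\<^sub>R e) = 0" if "x \<notin> (\<lambda>y. y - h n *\<^sub>R e) ` S" for x
      using that S(2)[of "x + h n *\<^sub>R e"] by (force simp: image_iff)
    moreover have "compact ((\<lambda>y. y - h n *\<^sub>R e) ` S)"
      using S(1) by (intro compact_continuous_image continuous_intros)
    ultimately have "integrable lborel (\<lambda>x. \<phi> (x + h n *\<^sub>R e))"
      using integrable_continuous_compact_support by blast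
    moreover have "(\<integral>x. \<phi> (x + h n *\<^sub>R e) \<partial>lborel) = (\<integral>x. \<phi> x \<partial>lborel)"
      by (rule integral_lborel_translation) (simp add: borel_measurable_continuous_onI[OF cont])
    ultimately show ?thesis using int\<phi> by (simp add: q_def)
  qed
  have lim: "(\<lambda>n. q n x) \<longlonglongrightarrow> \<phi>' x e" for x
  proof -
    have "((\<lambda>s. (\<phi> (x + s *\<^sub>R e) - \<phi> x) / s) \<longlongrightarrow> \<phi>' x e) (at 0)"
    proof -
      have "((\<lambda>s. \<phi> (x + s *\<^sub>R e)) has_derivative (\<lambda>k. \<phi>' (x + 0 *\<^sub>R e) (k *\<^sub>R e))) (at 0)"
        by (rule has_derivative_compose[OF _ d]) (auto intro!: derivative_eq_intros)
      moreover have "\<phi>' x (k *\<^sub>R e) = \<phi>' x e * k" for k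
        using has_derivative_linear[OF d] by (simp add: linear_cmul)
      ultimately have "((\<lambda>s. \<phi> (x + s *\<^sub>R e)) has_real_derivative \<phi>' x e) (at 0)"
        by (simp add: has_field_derivative_def)
      then show ?thesis by (simp add: DERIV_def)
    qed
    moreover have "h \<longlonglongrightarrow> 0" unfolding h_def[abs_def] by (rule LIMSEQ_Suc[OF lim_1_over_n])
    then have "filterlim h (at 0) sequentially"
      unfolding filterlim_at using h(1) by (auto simp: less_imp_neq[symmetric])
    ultimately show ?thesis unfolding q_def by (rule filterlim_compose)
  qed
  have "(\<lambda>n. \<integral>x. q n x \<partial>lborel) \<longlonglongrightarrow> (\<integral>x. \<phi>' x e \<partial>lborel)"
  proof (rule integral_dominated_convergence[where w = "\<lambda>x. B * indicator T x"])
    show "integrable lborel (\<lambda>x. B * indicator T x)"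
      using emeasure_lborel_cball_finite[of "0::'a" "R0 + norm e"] by (simp add: T_def)
    show "AE x in lborel. norm (q n x) \<le> B * indicator T x" for n
      using qb[of n] qz[of _ n] by (intro AE_I2) (auto simp: indicator_def)
  qed (use lim qm int in auto)
  then have "(\<integral>x. \<phi>' x e \<partial>lborel) = 0" by (simp add: q0 LIMSEQ_const_iff)
  with int show ?thesis by (simp add: has_bochner_integral_iff)
qed

text \<open>The divergence is the sum over the basis of the derivative of the component
  \<open>W x \<bullet> b\<close> in direction \<open>b\<close>, and each of these integrates to
  zero.\<close>

lemma integral_divergence_eq_0:
  fixes W :: "'a::euclidean_space \<Rightarrow> 'a"
  assumes \<Omega>: "open \<Omega>" "S \<subseteq> \<Omega>" and S: "compact S"
    and d: "\<And>x. x \<in> \<Omega> \<Longrightarrow> (W has_derivative W' x) (at x)"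
    and c: "\<And>e. e \<in> Basis \<Longrightarrow> continuous_on \<Omega> (\<lambda>x. W' x e)"
    and Wz: "\<And>x. x \<notin> S \<Longrightarrow> W x = 0"
    and \<psi>: "\<And>x. x \<in> \<Omega> \<Longrightarrow> \<psi> x = (\<Sum>b\<in>Basis. W' x b \<bullet> b)"
    and \<psi>z: "\<And>x. x \<notin> S \<Longrightarrow> \<psi> x = 0"
  shows "has_bochner_integral lborel \<psi> (0::real)"
proof -
  \<comment> \<open>Nothing is known of \<open>W'\<close> outside \<open>\<Omega>\<close>. Cutting
    it off to zero outside \<open>S\<close> gives a derivative of \<open>W\<close> on the whole
    space.\<close>
  define D where "D x = (if x \<in> S then W' x else (\<lambda>h. 0))" for x
  have D\<Omega>: "W' x = D x" if "x \<in> \<Omega>" for x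
    using has_derivative_eq_zero_off[OF d[OF that] compact_imp_closed[OF S], of ] Wz by (auto simp: D_def)
  have dW: "(W has_derivative D x) (at x)" for x
  proof (cases "x \<in> S")
    case True then show ?thesis using d \<Omega> by (auto simp: D_def)
  next
    case False
    have "(W has_derivative (\<lambda>h. 0)) (at x)"
      by (rule has_derivative_transform_within_open[of "\<lambda>_. 0" _ _ _ "- S"])
         (use False Wz compact_imp_closed[OF S] in \<open>auto simp: open_Compl\<close>)
    then show ?thesis using False by (simp add: D_def)
  qed
  have "has_bochner_integral lborel (\<lambda>x. D x b \<bullet> b) 0" if b: "b \<in> Basis" for b
  proof (rule integral_directional_derivative_eq_0[OF _ _ S, where \<phi>' = "\<lambda>x h. D x h \<bullet> b" and e = b])
    show "((\<lambda>x. W x \<bullet> b) has_derivative (\<lambda>h. D x h \<bullet> b)) (at x)" for x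
      using dW by (auto intro!: derivative_eq_intros)
    have "continuous_on \<Omega> (\<lambda>x. D x b)"
      using c[OF b] D\<Omega> continuous_on_cong[of \<Omega> \<Omega> "\<lambda>x. W' x b" "\<lambda>x. D x b"] by simp
    then have "continuous_on UNIV (\<lambda>x. D x b)"
      by (rule continuous_on_UNIV_zero_off[OF _ \<Omega>(1) compact_imp_closed[OF S] \<Omega>(2)]) (simp add: D_def)
    then show "continuous_on UNIV (\<lambda>x. D x b \<bullet> b)" by (intro continuous_intros)
    show "W x \<bullet> b = 0" if "x \<notin> S" for x using Wz[OF that] by simp
  qed
  then have "has_bochner_integral lborel (\<lambda>x. \<Sum>b\<in>Basis. D x b \<bullet> b) (\<Sum>b\<in>(Basis::'a set). 0)"
    by (rule has_bochner_integral_sum)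
  moreover have "(\<lambda>x. \<Sum>b\<in>Basis. D x b \<bullet> b) = \<psi>"
    using \<psi> \<psi>z \<Omega>(2) by (auto simp: fun_eq_iff D_def subset_iff)
  ultimately show ?thesis by simp
qed

lemma trace_rank_one:
  fixes w :: "'a::euclidean_space"
  assumes "linear \<l>"
  shows "(\<Sum>b\<in>Basis. (\<l> b *\<^sub>R w) \<bullet> b) = (\<l> w :: real)"
proof -
  have "\<l> w = \<l> (\<Sum>b\<in>Basis. (w \<bullet> b) *\<^sub>R b)" by (simp add: euclidean_representation)
  also have "\<dots> = (\<Sum>b\<in>Basis. (w \<bullet> b) * \<l> b)"
    using assms by (simp add: linear_sum linear_cmul)
  finally show ?thesis by (simp add: mult.commute)
qed

section \<open>Symmetry of second derivatives\<close>

lemma second_difference_mean_value: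
  fixes u :: "'a::real_normed_vector \<Rightarrow> real"
  assumes u: "\<And>x. (u has_derivative D x) (at x)"
    and De: "\<And>x. ((\<lambda>y. D y e) has_derivative D2 x) (at x)" and h: "h > 0"
  shows "\<exists>s k. 0 < s \<and> s < h \<and> 0 < k \<and> k < h \<and>
    u (x + h *\<^sub>R e + h *\<^sub>R f) - u (x + h *\<^sub>R e) - u (x + h *\<^sub>R f) + u x
      = h\<^sup>2 * D2 (x + s *\<^sub>R e + k *\<^sub>R f) f"
proof -
  have line: "((\<lambda>s. w (y + s *\<^sub>R a)) has_real_derivative W (y + s *\<^sub>R a) a) (at s)"
    if w: "\<And>z. (w has_derivative W z) (at z)" for w :: "'a \<Rightarrow> real" and W y a s
  proof -
    have "((\<lambda>s. w (y + s *\<^sub>R a)) has_derivative (\<lambda>k. W (y + s *\<^sub>R a) (k *\<^sub>R a))) (at s)"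
      by (rule has_derivative_compose[OF _ w]) (auto intro!: derivative_eq_intros)
    moreover have "W (y + s *\<^sub>R a) (k *\<^sub>R a) = W (y + s *\<^sub>R a) a * k" for k
      using has_derivative_linear[OF w] by (simp add: linear_cmul)
    ultimately show ?thesis by (simp add: has_field_derivative_def)
  qed
  \<comment> \<open>The mean value theorem is applied in direction \<open>e\<close> to the increment
    of \<open>u\<close> by \<open>h *\<^sub>R f\<close>, and afterwards in direction
    \<open>f\<close> to the resulting increment of the derivative.\<close>
  have "((\<lambda>s. u ((x + h *\<^sub>R f) + s *\<^sub>R e) - u (x + s *\<^sub>R e)) has_real_derivative
      D ((x + h *\<^sub>R f) + s *\<^sub>R e) e - D (x + s *\<^sub>R e) e) (at s)" for s
    by (intro derivative_intros line u)
  from MVT2[OF h this] obtain s where s: "0 < s" "s < h" and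
    1: "u ((x + h *\<^sub>R f) + h *\<^sub>R e) - u (x + h *\<^sub>R e) - (u (x + h *\<^sub>R f) - u x) =
     h * (D ((x + h *\<^sub>R f) + s *\<^sub>R e) e - D (x + s *\<^sub>R e) e)"
    by auto
  have "((\<lambda>k. D ((x + s *\<^sub>R e) + k *\<^sub>R f) e) has_real_derivative D2 ((x + s *\<^sub>R e) + k *\<^sub>R f) f) (at k)" for k
    using line[of "\<lambda>y. D y e", OF De] .
  from MVT2[OF h this] obtain k where k: "0 < k" "k < h" and
    2: "D ((x + s *\<^sub>R e) + h *\<^sub>R f) e - D (x + s *\<^sub>R e) e = h * D2 ((x + s *\<^sub>R e) + k *\<^sub>R f) f"
    by auto
  have "(x + h *\<^sub>R f) + s *\<^sub>R e = (x + s *\<^sub>R e) + h *\<^sub>R f" by simp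
  then show ?thesis using 1 2 s k
    by (intro exI[of _ s] exI[of _ k]) (simp add: algebra_simps power2_eq_square)
qed

text \<open>The second difference of \<open>u\<close> is symmetric in \<open>e\<close> and
  \<open>f\<close>. Divided by the squared step, it is a value of either mixed derivative at points
  that tend to \<open>x\<close>, so by continuity the two limits agree.\<close>

lemma second_derivative_symmetric:
  fixes u :: "'a::real_normed_vector \<Rightarrow> real"
  assumes u: "\<And>x. (u has_derivative D x) (at x)"
    and D: "\<And>e x. ((\<lambda>y. D y e) has_derivative D2 e x) (at x)"
    and c: "\<And>e f. continuous_on UNIV (\<lambda>x. D2 e x f)"
  shows "D2 e x f = D2 f x e"
proof -
  define h where "h n = 1 / real (Suc n)" for n
  have h: "0 < h n" for n by (auto simp: h_def)
  have hl: "h \<longlonglongrightarrow> 0" unfolding h_def[abs_def] by (rule LIMSEQ_Suc[OF lim_1_over_n])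
  have tend: "(\<lambda>n. D2 e (x + s n *\<^sub>R a + k n *\<^sub>R b) f) \<longlonglongrightarrow> D2 e x f"
    if "\<And>n. 0 < s n" "\<And>n. s n < h n" "\<And>n. 0 < k n" "\<And>n. k n < h n" for s k e f a b
  proof -
    have "s \<longlonglongrightarrow> 0" "k \<longlonglongrightarrow> 0"
      using that by (auto intro!: tendsto_sandwich[OF _ _ tendsto_const hl] always_eventually less_imp_le)
    then have "(\<lambda>n. x + s n *\<^sub>R a + k n *\<^sub>R b) \<longlonglongrightarrow> x + 0 *\<^sub>R a + 0 *\<^sub>R b"
      by (intro tendsto_intros)
    then show ?thesis
      using continuous_on_tendsto_compose[OF c[of e f], of _ x sequentially] by simp
  qed
  have "\<forall>n. \<exists>s k. 0 < s \<and> s < h n \<and> 0 < k \<and> k < h n \<and>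
    u (x + h n *\<^sub>R e + h n *\<^sub>R f) - u (x + h n *\<^sub>R e) - u (x + h n *\<^sub>R f) + u x
      = (h n)\<^sup>2 * D2 e (x + s *\<^sub>R e + k *\<^sub>R f) f"
    using second_difference_mean_value[OF u D h] by blast
  then obtain s k where sk: "\<And>n. 0 < s n" "\<And>n. s n < h n" "\<And>n. 0 < k n" "\<And>n. k n < h n"
    "\<And>n. u (x + h n *\<^sub>R e + h n *\<^sub>R f) - u (x + h n *\<^sub>R e) - u (x + h n *\<^sub>R f) + u x
      = (h n)\<^sup>2 * D2 e (x + s n *\<^sub>R e + k n *\<^sub>R f) f"
    by metis
  have "\<forall>n. \<exists>s k. 0 < s \<and> s < h n \<and> 0 < k \<and> k < h n \<and>
    u (x + h n *\<^sub>R f + h n *\<^sub>R e) - u (x + h n *\<^sub>R f) - u (x + h n *\<^sub>R e) + u x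
      = (h n)\<^sup>2 * D2 f (x + s *\<^sub>R f + k *\<^sub>R e) e"
    using second_difference_mean_value[OF u D h] by blast
  then obtain s' k' where sk': "\<And>n. 0 < s' n" "\<And>n. s' n < h n" "\<And>n. 0 < k' n" "\<And>n. k' n < h n"
    "\<And>n. u (x + h n *\<^sub>R f + h n *\<^sub>R e) - u (x + h n *\<^sub>R f) - u (x + h n *\<^sub>R e) + u x
      = (h n)\<^sup>2 * D2 f (x + s' n *\<^sub>R f + k' n *\<^sub>R e) e"
    by metis
  have "D2 e (x + s n *\<^sub>R e + k n *\<^sub>R f) f = D2 f (x + s' n *\<^sub>R f + k' n *\<^sub>R e) e" for n
  proof -
    have "x + h n *\<^sub>R e + h n *\<^sub>R f = x + h n *\<^sub>R f + h n *\<^sub>R e" by (simp add: add_ac)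
    then have "u (x + h n *\<^sub>R e + h n *\<^sub>R f) = u (x + h n *\<^sub>R f + h n *\<^sub>R e)" by (rule arg_cong)
    then have "(h n)\<^sup>2 * D2 e (x + s n *\<^sub>R e + k n *\<^sub>R f) f = (h n)\<^sup>2 * D2 f (x + s' n *\<^sub>R f + k' n *\<^sub>R e) e"
      using sk(5)[of n] sk'(5)[of n] by linarith
    then show ?thesis using h[of n] by simp
  qed
  then show ?thesis
    using tend[OF sk(1-4), of e e f f] tend[OF sk'(1-4), of f f e e] LIMSEQ_unique by simp
qed

section \<open>The Poincare ball with a pole\<close>

text \<open>The hyperbolic metric is \<open>(conf x)\<^sup>2\<close> times the Euclidean one. The
  inner product in place of the squared norm keeps later identities rational in inner
  products.\<close>

definition conf :: "'a::euclidean_space \<Rightarrow> real" where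
  "conf x = 2 / (1 - x \<bullet> x)"

text \<open>\<^term>\<open>coshd a x\<close> is the hyperbolic cosine of the distance from \<open>x\<close> to \<open>a\<close>, and \<^term>\<open>pvec a\<close> below is
  its Riemannian gradient, a conformal field equal to \<open>sinh r \<partial>\<^sub>r\<close>.\<close>

definition coshd :: "'a::euclidean_space \<Rightarrow> 'a \<Rightarrow> real" where
  "coshd a x = 1 + 2 * ((x - a) \<bullet> (x - a)) / ((1 - x \<bullet> x) * (1 - a \<bullet> a))"

text \<open>A closed form of the distance to the pole; \<open>hyp_dist_eq_rad\<close> identifies it
  with the infimum of the lengths of curves.\<close>

definition rad :: "'a::euclidean_space \<Rightarrow> 'a \<Rightarrow> real" where
  "rad a x = arcosh (coshd a x)"

definition pvec :: "'a::euclidean_space \<Rightarrow> 'a \<Rightarrow> 'a" where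
  "pvec a x = (((x - a) \<bullet> (x - a)) *\<^sub>R x + (1 - x \<bullet> x) *\<^sub>R (x - a)) /\<^sub>R (1 - a \<bullet> a)"

definition pvec_deriv :: "'a::euclidean_space \<Rightarrow> 'a \<Rightarrow> 'a \<Rightarrow> 'a" where
  "pvec_deriv a x h = (((x - a) \<bullet> (x - a)) *\<^sub>R h + (2 * ((x - a) \<bullet> h)) *\<^sub>R x
     + (1 - x \<bullet> x) *\<^sub>R h - (2 * (x \<bullet> h)) *\<^sub>R (x - a)) /\<^sub>R (1 - a \<bullet> a)"

text \<open>The Euclidean conformal factor of the field \<open>pvec a\<close>: the symmetric part of
  \<open>pvec_deriv a x\<close> is \<open>pfac a x\<close> times the identity.\<close>

definition pfac :: "'a::euclidean_space \<Rightarrow> 'a \<Rightarrow> real" where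
  "pfac a x = ((x - a) \<bullet> (x - a) + 1 - x \<bullet> x) / (1 - a \<bullet> a)"

lemma inner_self_less_1: "norm (x::'a::euclidean_space) < 1 \<Longrightarrow> x \<bullet> x < 1"
  by (simp add: dot_square_norm power_less_one_iff)

lemma has_derivative_imp_continuous_on:
  assumes "\<And>x. x \<in> A \<Longrightarrow> (f has_derivative D x) (at x)"
  shows "continuous_on A f"
  using assms has_derivative_continuous by (blast intro: continuous_at_imp_continuous_on)

lemma trace_mult_scaled:
  fixes w :: "'a::euclidean_space"
  assumes "linear \<l>"
  shows "(\<Sum>b\<in>Basis. (\<l> b *\<^sub>R w + c *\<^sub>R M b) \<bullet> b) = \<l> w + c * (\<Sum>b\<in>Basis. M b \<bullet> b)"
  using trace_rank_one[OF assms, of w]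
  by (simp add: inner_add_left sum.distrib sum_distrib_left)

text \<open>The product rule for the field \<open>\<phi> V\<close>: its divergence is the derivative
  of \<open>\<phi>\<close> along \<open>V\<close> plus \<open>\<phi>\<close> times the trace of the
  derivative of \<open>V\<close>.\<close>

lemma integral_divergence_scaled:
  fixes V :: "'a::euclidean_space \<Rightarrow> 'a"
  assumes \<Omega>: "open \<Omega>" "S \<subseteq> \<Omega>" and S: "compact S"
    and d\<phi>: "\<And>x. x \<in> \<Omega> \<Longrightarrow> (\<phi> has_derivative \<l> x) (at x)"
    and dV: "\<And>x. x \<in> \<Omega> \<Longrightarrow> (V has_derivative M x) (at x)"
    and c: "\<And>e. continuous_on \<Omega> (\<lambda>x. \<l> x e)" "\<And>e. continuous_on \<Omega> (\<lambda>x. M x e)"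
    and z: "\<And>x. x \<notin> S \<Longrightarrow> \<phi> x = 0" "\<And>x. x \<notin> S \<Longrightarrow> \<psi> x = 0"
    and \<psi>: "\<And>x. x \<in> \<Omega> \<Longrightarrow> \<psi> x = \<l> x (V x) + \<phi> x * (\<Sum>b\<in>Basis. M x b \<bullet> b)"
  shows "has_bochner_integral lborel \<psi> (0::real)"
proof (rule integral_divergence_eq_0[OF \<Omega> S, where W = "\<lambda>x. \<phi> x *\<^sub>R V x"
      and W' = "\<lambda>x h. \<l> x h *\<^sub>R V x + \<phi> x *\<^sub>R M x h"])
  show "((\<lambda>x. \<phi> x *\<^sub>R V x) has_derivative (\<lambda>h. \<l> x h *\<^sub>R V x + \<phi> x *\<^sub>R M x h)) (at x)"
    if "x \<in> \<Omega>" for x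
    using has_derivative_scaleR[OF d\<phi>[OF that] dV[OF that]] by (simp add: add.commute)
  have "continuous_on \<Omega> \<phi>" "continuous_on \<Omega> V"
    using d\<phi> dV by (blast intro: has_derivative_imp_continuous_on)+
  then show "continuous_on \<Omega> (\<lambda>x. \<l> x e *\<^sub>R V x + \<phi> x *\<^sub>R M x e)" for e
    by (intro continuous_intros c)
  show "\<psi> x = (\<Sum>b\<in>Basis. (\<l> x b *\<^sub>R V x + \<phi> x *\<^sub>R M x b) \<bullet> b)" if "x \<in> \<Omega>" for x
    using \<psi>[OF that] trace_mult_scaled[OF has_derivative_linear[OF d\<phi>[OF that]]] by metis
qed (use z in auto)

section \<open>Calculus of the distance and of its conformal field\<close>

locale pole =
  fixes a :: "'a::euclidean_space"
  assumes pole: "norm a < 1"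
begin

text \<open>The pole is removed because \<open>rad a\<close> is not differentiable there and
  \<open>sinh (rad a x)\<close>, which occurs in denominators, vanishes there.\<close>

definition \<Omega> :: "'a set" where "\<Omega> = ball 0 1 - {a}"

lemma open_Omega: "open \<Omega>" by (simp add: \<Omega>_def open_delete)

lemma a1: "1 - a \<bullet> a > 0" using inner_self_less_1[OF pole] by simp

lemma norm_Omega: "x \<in> \<Omega> \<Longrightarrow> norm x < 1" by (simp add: \<Omega>_def)

lemma x1: "norm (x::'a) < 1 \<Longrightarrow> 1 - x \<bullet> x > 0" using inner_self_less_1[of x] by simp

lemma conf_pos: "norm (x::'a) < 1 \<Longrightarrow> conf x > 0" using x1[of x] by (simp add: conf_def)

lemma conf_deriv:
  assumes "norm (x::'a) < 1" shows "(conf has_derivative (\<lambda>h. (conf x)\<^sup>2 * (x \<bullet> h))) (at x)"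
  unfolding conf_def[abs_def] using x1[OF assms]
  by (auto intro!: derivative_eq_intros simp: fun_eq_iff inner_commute power2_eq_square divide_simps)

lemma conf_power_deriv:
  assumes "norm (x::'a) < 1"
  shows "((\<lambda>x. conf x ^ k) has_derivative (\<lambda>h. real k * conf x ^ (k + 1) * (x \<bullet> h))) (at x)"
proof (cases k)
  case (Suc m)
  show ?thesis unfolding Suc
    by (rule has_derivative_eq_rhs[OF has_derivative_power[OF conf_deriv[OF assms]]])
       (simp add: fun_eq_iff power2_eq_square algebra_simps)
qed simp

lemma coshd_gt1: assumes "x \<in> \<Omega>" shows "coshd a x > 1"
proof -
  have "(x - a) \<bullet> (x - a) > 0" using assms by (simp add: \<Omega>_def)
  then show ?thesis using a1 x1[OF norm_Omega[OF assms]] by (simp add: coshd_def)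
qed

text \<open>The Riemannian gradient is the Euclidean one divided by \<open>(conf x)\<^sup>2\<close>;
  this formula is what makes \<open>pvec a\<close> the Riemannian gradient of
  \<open>coshd a\<close>.\<close>

lemma coshd_deriv:
  assumes "norm (x::'a) < 1" shows "(coshd a has_derivative (\<lambda>h. (conf x)\<^sup>2 * (pvec a x \<bullet> h))) (at x)"
proof -
  have ne: "(1 - x \<bullet> x) * (1 - a \<bullet> a) \<noteq> 0" using a1 x1[OF assms] by simp
  have "(coshd a has_derivative (\<lambda>h. (2 * (h \<bullet> (x - a) + (x - a) \<bullet> h) * ((1 - x \<bullet> x) * (1 - a \<bullet> a))
      + 2 * ((x - a) \<bullet> (x - a)) * ((h \<bullet> x + x \<bullet> h) * (1 - a \<bullet> a))) / ((1 - x \<bullet> x) * (1 - a \<bullet> a))\<^sup>2)) (at x)"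
    unfolding coshd_def[abs_def] using ne
    by (auto intro!: derivative_eq_intros simp: fun_eq_iff power2_eq_square algebra_simps diff_divide_distrib add_divide_distrib)
  then show ?thesis
    by (rule has_derivative_eq_rhs)
       (use a1 x1[OF assms] in \<open>simp add: fun_eq_iff conf_def pvec_def inner_add_left inner_commute
          power2_eq_square divide_simps, simp add: algebra_simps\<close>)
qed

lemma pvec_has_derivative: "(pvec a has_derivative pvec_deriv a x) (at x)"
  unfolding pvec_def[abs_def] pvec_deriv_def[abs_def] using a1
  by (auto intro!: derivative_eq_intros simp: fun_eq_iff inner_commute algebra_simps)

text \<open>The two rank-one terms of \<open>pvec_deriv a x\<close> form a skew map and cancel when
  paired with \<open>h\<close>; the other terms are multiples of \<open>h\<close>.\<close>

lemma pvec_deriv_inner: "pvec_deriv a x h \<bullet> h = pfac a x * (h \<bullet> h)"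
  using a1 by (simp add: pvec_deriv_def pfac_def inner_commute divide_simps)
    (simp add: algebra_simps inner_commute)

lemma pvec_deriv_trace: "(\<Sum>b\<in>Basis. pvec_deriv a x b \<bullet> b) = real DIM('a) * pfac a x"
proof -
  have "(\<Sum>b\<in>Basis. pvec_deriv a x b \<bullet> b) = (\<Sum>b\<in>(Basis::'a set). pfac a x * (b \<bullet> b))"
    by (simp only: pvec_deriv_inner)
  then show ?thesis by simp
qed

text \<open>This expresses that the hyperbolic Hessian of \<open>cosh r\<close> is
  \<open>cosh r\<close> times the metric: the Euclidean conformal factor of the gradient field and
  the logarithmic derivative of \<open>conf\<close> along it add up to
  \<open>cosh r\<close>.\<close>

lemma pfac_add: assumes "norm (x::'a) < 1" shows "pfac a x + conf x * (pvec a x \<bullet> x) = coshd a x"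
  using a1 x1[OF assms]
  by (simp add: pfac_def conf_def pvec_def coshd_def divide_simps)
     (simp add: algebra_simps inner_commute)

text \<open>The left-hand side is the squared Riemannian length of the gradient of
  \<open>cosh r\<close>. In this form the identity includes the pole, as curves ending there
  require.\<close>

lemma pvec_norm: assumes "norm (x::'a) < 1" shows "(conf x)\<^sup>2 * (pvec a x \<bullet> pvec a x) = (coshd a x)\<^sup>2 - 1"
  using a1 x1[OF assms]
  by (simp add: conf_def pvec_def coshd_def divide_simps power2_eq_square)
     (simp add: algebra_simps inner_commute)

lemma rad_pos: assumes "x \<in> \<Omega>" shows "rad a x > 0"
  using coshd_gt1[OF assms] by (simp add: rad_def)

lemma cosh_rad: assumes "x \<in> \<Omega>" shows "cosh (rad a x) = coshd a x"
  using coshd_gt1[OF assms] by (simp add: rad_def)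

lemma sinh_rad_pos: assumes "x \<in> \<Omega>" shows "sinh (rad a x) > 0"
  using rad_pos[OF assms] by simp

lemma pvec_norm': assumes "x \<in> \<Omega>" shows "(conf x)\<^sup>2 * (pvec a x \<bullet> pvec a x) = (sinh (rad a x))\<^sup>2"
  using pvec_norm[OF norm_Omega[OF assms]] cosh_rad[OF assms] by (simp add: sinh_square_eq)

lemma rad_deriv:
  assumes "x \<in> \<Omega>"
  shows "(rad a has_derivative (\<lambda>h. (conf x)\<^sup>2 * (pvec a x \<bullet> h) / sinh (rad a x))) (at x)"
proof -
  have "(arcosh has_real_derivative 1 / sinh (rad a x)) (at (coshd a x))"
    using arcosh_real_has_field_derivative[of "coshd a x" UNIV] coshd_gt1[OF assms]
    by (simp add: rad_def sinh_arcosh_real)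
  then have "((\<lambda>x. arcosh (coshd a x)) has_derivative
      (\<lambda>h. 1 / sinh (rad a x) * ((conf x)\<^sup>2 * (pvec a x \<bullet> h)))) (at x)"
    unfolding has_field_derivative_def by (rule has_derivative_compose[OF coshd_deriv[OF norm_Omega[OF assms]]])
  then show ?thesis by (simp add: rad_def[abs_def])
qed

lemma radial_deriv:
  assumes "x \<in> \<Omega>" and q: "\<And>r. r > 0 \<Longrightarrow> (q has_real_derivative q' r) (at r)"
  shows "((\<lambda>x. q (rad a x)) has_derivative
    (\<lambda>h. q' (rad a x) * ((conf x)\<^sup>2 * (pvec a x \<bullet> h) / sinh (rad a x)))) (at x)"
  using has_derivative_compose[OF rad_deriv[OF assms(1)] q[OF rad_pos[OF assms(1)], unfolded has_field_derivative_def]] .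

lemma continuous_Omega:
  "continuous_on \<Omega> conf" "continuous_on \<Omega> (rad a)" "continuous_on \<Omega> (pvec a)"
  "continuous_on \<Omega> (\<lambda>x. pvec_deriv a x e)"
  unfolding pvec_deriv_def
  using a1
  by (auto intro!: has_derivative_imp_continuous_on[OF conf_deriv[OF norm_Omega]]
      has_derivative_imp_continuous_on[OF rad_deriv] has_derivative_imp_continuous_on[OF pvec_has_derivative]
      continuous_intros)

lemma continuous_radial:
  "continuous_on {0<..} q \<Longrightarrow> continuous_on \<Omega> (\<lambda>x. q (rad a x))"
  by (rule continuous_on_compose2[OF _ continuous_Omega(2)]) (auto simp: rad_pos)

end

section \<open>Integration by parts\<close>

text \<open>\<open>v\<close> and \<open>H\<close> are the Euclidean gradient and Hessian of
  \<open>u\<close>. With dimension \<open>n + 2\<close>, the volume density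
  \<open>conf x ^ (n + 2)\<close> times the inverse metric factor
  \<open>1 / (conf x)\<^sup>2\<close> is \<open>conf x ^ n\<close>.\<close>

locale test_pole = pole a for a :: "'a::euclidean_space" +
  fixes u :: "'a \<Rightarrow> real" and v :: "'a \<Rightarrow> 'a" and H :: "'a \<Rightarrow> 'a \<Rightarrow> 'a" and S :: "'a set" and n :: nat
  assumes du: "(u has_derivative (\<lambda>h. v x \<bullet> h)) (at x)"
    and dv: "(v has_derivative H x) (at x)"
    and cH: "continuous_on UNIV (\<lambda>x. H x e)"
    and symH: "H x h \<bullet> k = h \<bullet> H x k"
    and S: "compact S" "S \<subseteq> \<Omega>" "x \<notin> S \<Longrightarrow> u x = 0"
    and dim: "DIM('a) = n + 2"
begin

lemma v_zero: assumes "x \<notin> S" shows "v x = 0"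
proof -
  have "(\<lambda>h. v x \<bullet> h) = (\<lambda>h. 0)"
    by (rule has_derivative_eq_zero_off[OF du compact_imp_closed[OF S(1)] assms S(3)])
  then show ?thesis by (metis inner_eq_zero_iff)
qed

lemma H_zero: assumes "x \<notin> S" shows "H x = (\<lambda>h. 0)"
  by (rule has_derivative_eq_zero_off[OF dv compact_imp_closed[OF S(1)] assms v_zero])

lemmas zero_off = S(3) v_zero H_zero

text \<open>The Laplace-Beltrami operator of a metric conformal to the Euclidean one; the
  first-order term uses that the Euclidean gradient of \<open>ln (conf x)\<close> is
  \<open>conf x *\<^sub>R x\<close>.\<close>

definition lap :: "'a \<Rightarrow> real" where
  "lap x = (\<Sum>b\<in>Basis. H x b \<bullet> b) / (conf x)\<^sup>2 + real n * (x \<bullet> v x) / conf x"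

lemma cont_uvH: "continuous_on A u" "continuous_on A v" "continuous_on A (\<lambda>x. H x e)"
  using has_derivative_imp_continuous_on[OF du] has_derivative_imp_continuous_on[OF dv]
    continuous_on_subset[OF cH] by auto

lemma Hv_lin: "linear (H x)" using has_derivative_linear[OF dv] .

lemma conf_ne: "x \<in> \<Omega> \<Longrightarrow> conf x \<noteq> 0" using conf_pos[OF norm_Omega, of x] by simp

lemma continuous_lap: "continuous_on \<Omega> lap"
  unfolding lap_def[abs_def] by (intro continuous_intros continuous_Omega cont_uvH ballI) (auto simp: conf_ne)

lemma integrable_Omega:
  assumes "continuous_on \<Omega> f" "\<And>x. x \<notin> S \<Longrightarrow> f x = (0::real)"
  shows "integrable lborel f"
  using integrable_continuous_compact_support[OF continuous_on_UNIV_zero_off[OF assms(1) open_Omega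
        compact_imp_closed[OF S(1)] S(2) assms(2)] S(1) assms(2)] by blast

text \<open>The divergence theorem for the field \<open>u^2 q(r) sinh r \<partial>\<^sub>r\<close>,
  where the hyperbolic divergence of \<open>sinh r \<partial>\<^sub>r\<close> is the dimension times
  \<open>cosh r\<close>.\<close>

lemma integral_radial_field:
  assumes q: "\<And>r. r > 0 \<Longrightarrow> (q has_real_derivative q' r) (at r)" and cq: "continuous_on {0<..} q'"
  shows "has_bochner_integral lborel (\<lambda>x. conf x ^ (n+2) * (2 * u x * q (rad a x) * (pvec a x \<bullet> v x)
     + (u x)\<^sup>2 * (q' (rad a x) * sinh (rad a x) + real (n+2) * q (rad a x) * cosh (rad a x)))) 0"
proof -
  define \<l> where "\<l> x h = (u x)\<^sup>2 * (conf x ^ (n+2) * (q' (rad a x) * ((conf x)\<^sup>2 * (pvec a x \<bullet> h) / sinh (rad a x)))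
      + (real (n+2) * conf x ^ (n+2+1) * (x \<bullet> h)) * q (rad a x)) + (2 * u x * (v x \<bullet> h)) * (conf x ^ (n+2) * q (rad a x))" for x h
  have cq0: "continuous_on {0<..} q"
    by (rule has_derivative_imp_continuous_on[OF q[unfolded has_field_derivative_def]]) auto
  show ?thesis
  proof (rule integral_divergence_scaled[OF open_Omega S(2,1), where V = "pvec a"
      and M = "pvec_deriv a" and \<l> = \<l> and \<phi> = "\<lambda>x. (u x)\<^sup>2 * (conf x ^ (n+2) * q (rad a x))"])
    fix x assume x: "x \<in> \<Omega>"
    have "((\<lambda>x. (u x)\<^sup>2) has_derivative (\<lambda>h. 2 * u x * (v x \<bullet> h))) (at x)"
      by (rule has_derivative_eq_rhs[OF has_derivative_power[OF du]]) (simp add: fun_eq_iff)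
    from has_derivative_mult[OF this has_derivative_mult[OF conf_power_deriv[OF norm_Omega[OF x], of "n+2"] radial_deriv[OF x q]]]
    show "((\<lambda>x. (u x)\<^sup>2 * (conf x ^ (n+2) * q (rad a x))) has_derivative \<l> x) (at x)"
      unfolding \<l>_def .
    \<comment> \<open>The correction to \<open>cosh\<close> cancels against the derivative of the
      power of \<open>conf\<close> along \<open>pvec a\<close>.\<close>
    have c: "pfac a x = cosh (rad a x) - conf x * (pvec a x \<bullet> x)"
      using pfac_add[OF norm_Omega[OF x]] cosh_rad[OF x] by simp
    have s: "conf x * (conf x * (pvec a x \<bullet> pvec a x)) = sinh (rad a x) * sinh (rad a x)"
      using pvec_norm'[OF x] by (simp add: power2_eq_square)
    have "sinh (rad a x) \<noteq> 0" using sinh_rad_pos[OF x] by simp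
    then show "conf x ^ (n+2) * (2 * u x * q (rad a x) * (pvec a x \<bullet> v x)
     + (u x)\<^sup>2 * (q' (rad a x) * sinh (rad a x) + real (n+2) * q (rad a x) * cosh (rad a x)))
      = \<l> x (pvec a x) + (u x)\<^sup>2 * (conf x ^ (n+2) * q (rad a x)) * (\<Sum>b\<in>Basis. pvec_deriv a x b \<bullet> b)"
      unfolding \<l>_def pvec_deriv_trace dim c by (simp add: s power2_eq_square inner_commute algebra_simps)
  next
    show "continuous_on \<Omega> (\<lambda>x. \<l> x e)" for e unfolding \<l>_def using sinh_rad_pos
      by (intro continuous_intros continuous_Omega cont_uvH continuous_radial[OF cq] continuous_radial[OF cq0] ballI) force+
  qed (use pvec_has_derivative continuous_Omega zero_off in auto)
qed

text \<open>Green's identity: the divergence theorem for \<open>2 g(r) u\<close> times the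
  Riemannian gradient of \<open>u\<close>. Writing the derivative of \<open>g\<close> as
  \<open>q r * sinh r\<close> turns the derivative of \<open>g(r)\<close> along the gradient into
  \<open>q (pvec \<bullet> v)\<close>.\<close>

lemma integral_laplace_mult:
  assumes g: "\<And>r. r > 0 \<Longrightarrow> (g has_real_derivative q r * sinh r) (at r)" and cq: "continuous_on {0<..} q"
  shows "has_bochner_integral lborel (\<lambda>x. conf x ^ (n+2) * (2 * g (rad a x) * u x * lap x
     + 2 * u x * q (rad a x) * (pvec a x \<bullet> v x)) + conf x ^ n * (2 * g (rad a x) * (v x \<bullet> v x))) 0"
proof -
  define \<l> where "\<l> x h = (2 * u x) * (conf x ^ n * ((q (rad a x) * sinh (rad a x)) * ((conf x)\<^sup>2 * (pvec a x \<bullet> h) / sinh (rad a x)))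
      + (real n * conf x ^ (n+1) * (x \<bullet> h)) * g (rad a x)) + (2 * (v x \<bullet> h)) * (conf x ^ n * g (rad a x))" for x h
  have cg: "continuous_on {0<..} g"
    by (rule has_derivative_imp_continuous_on[OF g[unfolded has_field_derivative_def]]) auto
  show ?thesis
  proof (rule integral_divergence_scaled[OF open_Omega S(2,1), where V = v
      and M = H and \<l> = \<l> and \<phi> = "\<lambda>x. (2 * u x) * (conf x ^ n * g (rad a x))"])
    fix x assume x: "x \<in> \<Omega>"
    have "((\<lambda>x. 2 * u x) has_derivative (\<lambda>h. 2 * (v x \<bullet> h))) (at x)"
      by (auto intro!: derivative_eq_intros du)
    from has_derivative_mult[OF this has_derivative_mult[OF conf_power_deriv[OF norm_Omega[OF x]] radial_deriv[OF x g]]]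
    show "((\<lambda>x. (2 * u x) * (conf x ^ n * g (rad a x))) has_derivative \<l> x) (at x)"
      unfolding \<l>_def by simp
    have "sinh (rad a x) \<noteq> 0" using sinh_rad_pos[OF x] by simp
    then show "conf x ^ (n+2) * (2 * g (rad a x) * u x * lap x
     + 2 * u x * q (rad a x) * (pvec a x \<bullet> v x)) + conf x ^ n * (2 * g (rad a x) * (v x \<bullet> v x))
      = \<l> x (v x) + (2 * u x) * (conf x ^ n * g (rad a x)) * (\<Sum>b\<in>Basis. H x b \<bullet> b)"
      unfolding \<l>_def lap_def using conf_ne[OF x]
      by (simp add: power2_eq_square inner_commute power_add divide_simps) (simp add: algebra_simps)
  next
    show "continuous_on \<Omega> (\<lambda>x. \<l> x e)" for e unfolding \<l>_def using sinh_rad_pos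
      by (intro continuous_intros continuous_Omega cont_uvH continuous_radial[OF cq] continuous_radial[OF cg] ballI) force+
  qed (use dv cH zero_off continuous_on_subset[OF cH] in \<open>auto simp: lap_def\<close>)
qed

text \<open>With \<open>X = F(r) sinh r \<partial>\<^sub>r\<close>, this is the divergence of
  \<open>2 (X u)\<close> times the gradient of \<open>u\<close>, minus that of the squared gradient
  length times \<open>X\<close>. The Hessian terms cancel by symmetry, and conformality leaves only
  a multiple of the squared gradient from the derivative of the field.\<close>

lemma integral_pohozaev:
  assumes F: "\<And>r. r > 0 \<Longrightarrow> (F has_real_derivative F' r) (at r)" and cF': "continuous_on {0<..} F'"
  shows "has_bochner_integral lborel (\<lambda>x. conf x ^ (n+2) * (2 * F (rad a x) * (pvec a x \<bullet> v x) * lap x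
     + 2 * F' (rad a x) * (pvec a x \<bullet> v x)\<^sup>2 / sinh (rad a x))
     - conf x ^ n * (v x \<bullet> v x) * (F' (rad a x) * sinh (rad a x) + real n * F (rad a x) * cosh (rad a x))) 0"
proof -
  have cF: "continuous_on {0<..} F"
    by (rule has_derivative_imp_continuous_on[OF F[unfolded has_field_derivative_def]]) auto
  \<comment> \<open>The volume density, one inverse metric factor and \<open>F\<close> combined, so
    that both fields have Euclidean expressions in \<open>v\<close> and
    \<open>pvec a\<close>.\<close>
  define m where "m x = conf x ^ n * F (rad a x)" for x
  define m' where "m' x h = conf x ^ n * (F' (rad a x) * ((conf x)\<^sup>2 * (pvec a x \<bullet> h) / sinh (rad a x)))
      + (real n * conf x ^ (n+1) * (x \<bullet> h)) * F (rad a x)" for x h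
  have dm: "(m has_derivative m' x) (at x)" if x: "x \<in> \<Omega>" for x
    using has_derivative_mult[OF conf_power_deriv[OF norm_Omega[OF x]] radial_deriv[OF x F]]
    unfolding m_def[abs_def] m'_def by simp
  have cm': "continuous_on \<Omega> (\<lambda>x. m' x e)" for e unfolding m'_def using sinh_rad_pos
    by (intro continuous_intros continuous_Omega cont_uvH continuous_radial[OF cF] continuous_radial[OF cF'] ballI) force+
  have cm: "continuous_on \<Omega> m" using dm by (rule has_derivative_imp_continuous_on)
  define \<l>1 where "\<l>1 x h = 2 * m x * (pvec a x \<bullet> H x h + pvec_deriv a x h \<bullet> v x) + 2 * m' x h * (pvec a x \<bullet> v x)" for x h
  have 1: "has_bochner_integral lborel (\<lambda>x. \<l>1 x (v x) + 2 * m x * (pvec a x \<bullet> v x) * (\<Sum>b\<in>Basis. H x b \<bullet> b)) 0"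
  proof (rule integral_divergence_scaled[OF open_Omega S(2,1), where V = v
      and M = H and \<l> = \<l>1 and \<phi> = "\<lambda>x. 2 * m x * (pvec a x \<bullet> v x)"])
    fix x assume x: "x \<in> \<Omega>"
    have "((\<lambda>x. 2 * m x) has_derivative (\<lambda>h. 2 * m' x h)) (at x)"
      by (auto intro!: derivative_eq_intros dm x)
    from has_derivative_mult[OF this has_derivative_inner[OF pvec_has_derivative dv]]
    show "((\<lambda>x. 2 * m x * (pvec a x \<bullet> v x)) has_derivative \<l>1 x) (at x)"
      unfolding \<l>1_def .
  next
    show "continuous_on \<Omega> (\<lambda>x. \<l>1 x e)" for e unfolding \<l>1_def
      by (intro continuous_intros continuous_Omega cont_uvH cm' cm)
  qed (use dv cont_uvH in \<open>auto simp: zero_off \<l>1_def linear_0[OF Hv_lin] has_derivative_linear[OF pvec_has_derivative, THEN linear_0]\<close>)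
  define \<l>2 where "\<l>2 x h = m x * (v x \<bullet> H x h + H x h \<bullet> v x) + m' x h * (v x \<bullet> v x)" for x h
  have 2: "has_bochner_integral lborel (\<lambda>x. \<l>2 x (pvec a x) + m x * (v x \<bullet> v x) * (\<Sum>b\<in>Basis. pvec_deriv a x b \<bullet> b)) 0"
  proof (rule integral_divergence_scaled[OF open_Omega S(2,1), where V = "pvec a"
      and M = "pvec_deriv a" and \<l> = \<l>2 and \<phi> = "\<lambda>x. m x * (v x \<bullet> v x)"])
    fix x assume x: "x \<in> \<Omega>"
    from has_derivative_mult[OF dm[OF x] has_derivative_inner[OF dv dv]]
    show "((\<lambda>x. m x * (v x \<bullet> v x)) has_derivative \<l>2 x) (at x)"
      unfolding \<l>2_def .
  next
    show "continuous_on \<Omega> (\<lambda>x. \<l>2 x e)" for e unfolding \<l>2_def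
      by (intro continuous_intros continuous_Omega cont_uvH cm' cm)
  qed (use pvec_has_derivative continuous_Omega in \<open>auto simp: zero_off \<l>2_def\<close>)
  have "(\<lambda>x. conf x ^ (n+2) * (2 * F (rad a x) * (pvec a x \<bullet> v x) * lap x
     + 2 * F' (rad a x) * (pvec a x \<bullet> v x)\<^sup>2 / sinh (rad a x))
     - conf x ^ n * (v x \<bullet> v x) * (F' (rad a x) * sinh (rad a x) + real n * F (rad a x) * cosh (rad a x)))
    = (\<lambda>x. (\<l>1 x (v x) + 2 * m x * (pvec a x \<bullet> v x) * (\<Sum>b\<in>Basis. H x b \<bullet> b))
      - (\<l>2 x (pvec a x) + m x * (v x \<bullet> v x) * (\<Sum>b\<in>Basis. pvec_deriv a x b \<bullet> b)))"
    (is "?L = ?R")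
  proof
    fix x show "?L x = ?R x"
    proof (cases "x \<in> \<Omega>")
      case False
      then have "x \<notin> S" using S(2) by auto
      then show ?thesis
        by (simp add: zero_off \<l>1_def \<l>2_def linear_0[OF Hv_lin] has_derivative_linear[OF pvec_has_derivative, THEN linear_0])
    next
      case x: True
      have c: "pfac a x = cosh (rad a x) - conf x * (pvec a x \<bullet> x)"
        using pfac_add[OF norm_Omega[OF x]] cosh_rad[OF x] by simp
      have s: "conf x * (conf x * (pvec a x \<bullet> pvec a x)) = sinh (rad a x) * sinh (rad a x)"
        using pvec_norm'[OF x] by (simp add: power2_eq_square)
      \<comment> \<open>Both Hessian terms become the same expression and drop out of the
        difference.\<close>
      have h: "H x (pvec a x) \<bullet> v x = pvec a x \<bullet> H x (v x)" "v x \<bullet> H x (pvec a x) = pvec a x \<bullet> H x (v x)"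
        by (simp_all only: symH inner_commute[of "v x"])
      show ?thesis
        unfolding \<l>1_def \<l>2_def m_def m'_def lap_def pvec_deriv_trace dim c h
        pvec_deriv_inner[of x "v x"]
        using conf_ne[OF x] sinh_rad_pos[OF x]
        by (simp add: s power2_eq_square inner_commute power_add divide_simps) (simp add: s algebra_simps)
    qed
  qed
  then show ?thesis using has_bochner_integral_diff[OF 1 2] by simp
qed

text \<open>Cauchy-Schwarz: as \<open>pvec a\<close> is \<open>sinh r \<partial>\<^sub>r\<close>,
  this says that the radial derivative is at most the length of the gradient.\<close>

lemma radial_component_le:
  assumes "x \<in> \<Omega>"
  shows "(pvec a x \<bullet> v x)\<^sup>2 \<le> (sinh (rad a x))\<^sup>2 * ((v x \<bullet> v x) / (conf x)\<^sup>2)"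
proof -
  have "(pvec a x \<bullet> v x)\<^sup>2 \<le> (pvec a x \<bullet> pvec a x) * (v x \<bullet> v x)" by (rule Cauchy_Schwarz_ineq)
  also have "\<dots> = ((conf x)\<^sup>2 * (pvec a x \<bullet> pvec a x)) * ((v x \<bullet> v x) / (conf x)\<^sup>2)"
    using conf_ne[OF assms] by simp
  finally show ?thesis unfolding pvec_norm'[OF assms] .
qed

text \<open>Integrate \<open>(\<Delta>u + f u\<^sub>r + g u)\<^sup>2 \<ge> 0\<close> by parts, where \<open>f = F sinh\<close> and \<open>g' = q sinh\<close>.\<close>

lemma square_method:
  assumes F: "\<And>r. r > 0 \<Longrightarrow> (F has_real_derivative F' r) (at r)" and cF: "continuous_on {0<..} F'"
    and g: "\<And>r. r > 0 \<Longrightarrow> (g has_real_derivative q r * sinh r) (at r)"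
    and q: "\<And>r. r > 0 \<Longrightarrow> (q has_real_derivative q' r) (at r)" and cq: "continuous_on {0<..} q'"
    and c\<beta>: "continuous_on {0<..} \<beta>"
    and tangential: "\<And>r. r > 0 \<Longrightarrow> F' r * sinh r + real n * F r * cosh r - 2 * g r \<le> \<beta> r"
    and radial: "\<And>r. r > 0 \<Longrightarrow>
      (F r)\<^sup>2 * (sinh r)\<^sup>2 - F' r * sinh r + real n * F r * cosh r - 2 * g r \<le> \<beta> r"
    and zero_order: "\<And>r. r > 0 \<Longrightarrow> (g r)\<^sup>2 + q' r * sinh r + real (n+2) * q r * cosh r
      - (q r * sinh r * F r + g r * F' r) * sinh r - real (n+2) * (g r * F r) * cosh r \<le> 0"
  shows "0 \<le> (\<integral>x. conf x ^ (n+2) * ((lap x)\<^sup>2 + \<beta> (rad a x) * ((v x \<bullet> v x) / (conf x)\<^sup>2)) \<partial>lborel)"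
proof -
  have cF0: "continuous_on {0<..} F"
    by (rule has_derivative_imp_continuous_on[OF F[unfolded has_field_derivative_def]]) auto
  have cg0: "continuous_on {0<..} g"
    by (rule has_derivative_imp_continuous_on[OF g[unfolded has_field_derivative_def]]) auto
  have cq0: "continuous_on {0<..} q"
    by (rule has_derivative_imp_continuous_on[OF q[unfolded has_field_derivative_def]]) auto
  have gF: "((\<lambda>r. g r * F r) has_real_derivative q r * sinh r * F r + g r * F' r) (at r)" if "r > 0" for r
    using DERIV_mult[OF g[OF that] F[OF that]] by (simp add: mult_ac)
  have cgF: "continuous_on {0<..} (\<lambda>r. q r * sinh r * F r + g r * F' r)"
    by (intro continuous_intros cF0 cg0 cq0 cF)
  define Q where "Q x = conf x ^ (n+2) * (lap x + F (rad a x) * (pvec a x \<bullet> v x) + g (rad a x) * u x)\<^sup>2" for x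
  \<comment> \<open>Four integrands of integral zero. The first two remove the terms of
    \<open>Q\<close> containing \<open>lap\<close>, the third removes the term with \<open>q\<close>
    that the second introduces, and the fourth removes the mixed term of \<open>u\<close> and its
    radial derivative.\<close>
  define \<psi> where "\<psi> x = (conf x ^ (n+2) * (2 * F (rad a x) * (pvec a x \<bullet> v x) * lap x
     + 2 * F' (rad a x) * (pvec a x \<bullet> v x)\<^sup>2 / sinh (rad a x))
     - conf x ^ n * (v x \<bullet> v x) * (F' (rad a x) * sinh (rad a x) + real n * F (rad a x) * cosh (rad a x)))
    + (conf x ^ (n+2) * (2 * g (rad a x) * u x * lap x
     + 2 * u x * q (rad a x) * (pvec a x \<bullet> v x)) + conf x ^ n * (2 * g (rad a x) * (v x \<bullet> v x)))
    - conf x ^ (n+2) * (2 * u x * q (rad a x) * (pvec a x \<bullet> v x)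
     + (u x)\<^sup>2 * (q' (rad a x) * sinh (rad a x) + real (n+2) * q (rad a x) * cosh (rad a x)))
    + conf x ^ (n+2) * (2 * u x * (g (rad a x) * F (rad a x)) * (pvec a x \<bullet> v x)
     + (u x)\<^sup>2 * ((q (rad a x) * sinh (rad a x) * F (rad a x) + g (rad a x) * F' (rad a x)) * sinh (rad a x)
        + real (n+2) * (g (rad a x) * F (rad a x)) * cosh (rad a x)))" for x
  define \<Phi> where "\<Phi> x = conf x ^ (n+2) * ((lap x)\<^sup>2 + \<beta> (rad a x) * ((v x \<bullet> v x) / (conf x)\<^sup>2))" for x
  have "has_bochner_integral lborel \<psi> (0 + 0 - 0 + 0)"
    unfolding \<psi>_def[abs_def]
    using integral_pohozaev[OF F cF] integral_laplace_mult[OF g cq0] integral_radial_field[OF q cq]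
      integral_radial_field[OF gF cgF]
    by (intro has_bochner_integral_add has_bochner_integral_diff)
  then have \<psi>: "integrable lborel \<psi>" "(\<integral>x. \<psi> x \<partial>lborel) = 0"
    by (simp_all add: has_bochner_integral_iff)
  have "continuous_on \<Omega> Q"
    unfolding Q_def[abs_def]
    by (intro continuous_intros continuous_Omega cont_uvH continuous_lap continuous_radial cF0 cg0)
  then have Qi: "integrable lborel Q"
    by (rule integrable_Omega) (simp add: Q_def zero_off lap_def)
  have "continuous_on \<Omega> \<Phi>"
    unfolding \<Phi>_def[abs_def]
    by (intro continuous_intros continuous_Omega cont_uvH continuous_lap continuous_radial c\<beta> ballI)
       (simp add: conf_ne)
  then have \<Phi>i: "integrable lborel \<Phi>"
    by (rule integrable_Omega) (simp add: \<Phi>_def zero_off lap_def)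
  have le: "Q x - \<psi> x \<le> \<Phi> x" for x
  proof (cases "x \<in> \<Omega>")
    case False
    then have "x \<notin> S" using S(2) by auto
    then show ?thesis by (simp add: zero_off Q_def \<psi>_def \<Phi>_def lap_def)
  next
    case x: True
    define r w G where "r = rad a x" and "w = pvec a x \<bullet> v x" and "G = (v x \<bullet> v x) / (conf x)\<^sup>2"
    have r: "r > 0" using rad_pos[OF x] by (simp add: r_def)
    then have s: "sinh r > 0" by simp
    have G0: "G \<ge> 0" by (simp add: G_def)
    have vv: "conf x ^ n * (v x \<bullet> v x) = conf x ^ (n+2) * G"
      using conf_ne[OF x] by (simp add: G_def power2_eq_square)
    have w: "w\<^sup>2 \<le> (sinh r)\<^sup>2 * G"
      using radial_component_le[OF x] by (simp add: w_def r_def G_def)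
    \<comment> \<open>The coefficient of \<open>w\<^sup>2\<close> in \<open>Q x - \<psi> x\<close>,
      up to the density. The estimate is affine in \<open>w\<^sup>2\<close>, which ranges between 0
      and \<open>(sinh r)\<^sup>2 * G\<close>; the tangential and the radial hypothesis are the two
      extreme cases.\<close>
    define \<kappa> where "\<kappa> = (F r)\<^sup>2 - 2 * F' r / sinh r"
    have q1: "\<kappa> * w\<^sup>2 \<le> (\<beta> r - (F' r * sinh r + real n * F r * cosh r) + 2 * g r) * G"
    proof (cases "\<kappa> \<le> 0")
      case True
      then have "\<kappa> * w\<^sup>2 \<le> 0" by (simp add: mult_nonpos_nonneg)
      also have "0 \<le> (\<beta> r - (F' r * sinh r + real n * F r * cosh r) + 2 * g r) * G"
        using tangential[OF r] G0 by simp
      finally show ?thesis .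
    next
      case False
      then have "\<kappa> * w\<^sup>2 \<le> \<kappa> * ((sinh r)\<^sup>2 * G)" using w by simp
      also have "\<dots> = ((F r)\<^sup>2 * (sinh r)\<^sup>2 - 2 * F' r * sinh r) * G"
        using s by (simp add: \<kappa>_def field_simps power2_eq_square)
      also have "\<dots> \<le> (\<beta> r - (F' r * sinh r + real n * F r * cosh r) + 2 * g r) * G"
        using radial[OF r] G0 by (intro mult_right_mono) auto
      finally show ?thesis .
    qed
    have u0: "(u x)\<^sup>2 * ((g r)\<^sup>2 + q' r * sinh r + real (n+2) * q r * cosh r
      - (q r * sinh r * F r + g r * F' r) * sinh r - real (n+2) * (g r * F r) * cosh r) \<le> 0"
      using zero_order[OF r] by (simp add: mult_nonneg_nonpos)
    have "\<Phi> x - (Q x - \<psi> x) = conf x ^ (n+2) * (((\<beta> r - (F' r * sinh r + real n * F r * cosh r) + 2 * g r) * G - \<kappa> * w\<^sup>2)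
      - (u x)\<^sup>2 * ((g r)\<^sup>2 + q' r * sinh r + real (n+2) * q r * cosh r
      - (q r * sinh r * F r + g r * F' r) * sinh r - real (n+2) * (g r * F r) * cosh r))"
    proof -
      have vv': "conf x ^ n * (c * (v x \<bullet> v x)) = conf x ^ (n+2) * (c * G)" for c
        using vv by (simp add: mult.left_commute)
      have d: "2 * F' r * w\<^sup>2 / sinh r = 2 * F' r / sinh r * w\<^sup>2" by simp
      show ?thesis
        unfolding \<Phi>_def Q_def \<psi>_def r_def[symmetric] w_def[symmetric] G_def[symmetric] vv vv' \<kappa>_def d
        by (simp only: algebra_simps power2_eq_square)
    qed
    also have "\<dots> \<ge> 0" using q1 u0 conf_pos[OF norm_Omega[OF x]] by (intro mult_nonneg_nonneg) auto
    finally show ?thesis by simp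
  qed
  \<comment> \<open>\<open>conf\<close> may be negative outside the ball, but \<open>Q\<close>
    vanishes off \<open>S\<close>.\<close>
  have "0 \<le> Q x" for x
    using conf_pos[OF norm_Omega, of x] S(2) by (cases "x \<in> S") (auto simp: Q_def zero_off lap_def less_imp_le)
  then have "0 \<le> (\<integral>x. Q x \<partial>lborel)" by simp
  also have "\<dots> = (\<integral>x. Q x - \<psi> x \<partial>lborel)"
    using Qi \<psi> by simp
  also have "\<dots> \<le> (\<integral>x. \<Phi> x \<partial>lborel)"
    using le Qi \<psi>(1) \<Phi>i by (intro integral_mono) auto
  finally show ?thesis unfolding \<Phi>_def .
qed

end

section \<open>The radial inequalities\<close>

text \<open>The difference of the two sides vanishes at 0 and has derivative
  \<open>r * sinh r\<close>. The resulting bound \<open>r coth r \<ge> 1\<close> is the one fact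
  relating \<open>r\<close> to \<open>coth r\<close> in the weight estimates.\<close>

lemma sinh_le_mult_cosh: "0 \<le> r \<Longrightarrow> sinh r \<le> r * cosh (r::real)"
proof -
  assume r: "0 \<le> r"
  have "(\<lambda>r. r * cosh r - sinh r) 0 \<le> (\<lambda>r. r * cosh r - sinh r) r"
    by (rule DERIV_nonneg_imp_nondecreasing[OF r]) (auto intro!: exI derivative_eq_intros)
  then show ?thesis by simp
qed

text \<open>In terms of \<open>t / \<nu>\<close> the polynomial is a sum of products of nonnegative
  factors, once multiples of \<open>\<nu> - 2\<close> are split off. It arises from the weight of
  \<open>u^2\<close> for \<open>t \<le> \<nu>\<close> and \<open>r \<le> 1\<close>, with
  \<open>d = 1 - r\<close>.\<close>

lemma quartic_nonneg:
  fixes \<nu> t d :: real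
  assumes "\<nu> \<ge> 2" "0 \<le> t" "t \<le> \<nu>" "0 \<le> d" "d \<le> 1"
  shows "0 \<le> \<nu> * t\<^sup>2 - 2 * t\<^sup>2 * d * (\<nu>\<^sup>2 + (\<nu> - t)) + (\<nu> + (\<nu> - t)) * t^3 * d\<^sup>2
    + (\<nu>\<^sup>2 - \<nu>) * (\<nu>\<^sup>2 + 2 * (\<nu> - t)) * (d * (2 - d))"
proof -
  define \<tau> where "\<tau> = t / \<nu>"
  have \<tau>: "t = \<nu> * \<tau>" "0 \<le> \<tau>" "\<tau> \<le> 1" using assms by (auto simp: \<tau>_def)
  \<comment> \<open>\<open>X - d * Y\<close> is affine in \<open>d\<close>, so on the unit interval
    its sign is decided by the endpoint values \<open>X\<close> and \<open>X - Y\<close>.\<close>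
  define X Y where "X = 2 * (1 - \<tau>\<^sup>2) * (2 - \<tau>)" and "Y = 2 - \<tau> + \<tau>\<^sup>2 - 4 * \<tau>^3 + 2 * \<tau>^4"
  have p: "\<tau>\<^sup>2 \<le> 1" using \<tau> by (simp add: power_le_one)
  have X: "X \<ge> 0" unfolding X_def using \<tau> p by simp
  have "0 \<le> 2 * \<tau> * (1 - \<tau>)\<^sup>2 + (2 - \<tau>)" using \<tau> by simp
  then have "0 \<le> (1 - \<tau>) * (2 * \<tau> * (1 - \<tau>)\<^sup>2 + (2 - \<tau>))" using \<tau> by simp
  also have "\<dots> = X - Y" unfolding X_def Y_def by (simp add: algebra_simps power2_eq_square power3_eq_cube power4_eq_xxxx)
  finally have "X - Y \<ge> 0" .
  then have XY: "(1 - d) * X + d * (X - Y) \<ge> 0" using X assms by simp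
  have "0 \<le> (1 - \<tau>) * ((1 + \<tau>) + (1 - d) * (1 + \<tau> + \<tau>\<^sup>2 * (1 - \<tau>)) - \<tau>\<^sup>2 * (1 - \<tau>))"
  proof -
    have "\<tau>\<^sup>2 * (1 - \<tau>) \<le> 1 * 1" using \<tau> p by (intro mult_mono) auto
    moreover have "0 \<le> (1 - d) * (1 + \<tau> + \<tau>\<^sup>2 * (1 - \<tau>))" using \<tau> assms by simp
    ultimately show ?thesis using \<tau> by (intro mult_nonneg_nonneg) auto
  qed
  also have "\<dots> = 2 * (1 - \<tau>\<^sup>2) - d * (1 - 2 * \<tau>^3 + \<tau>^4)"
    by (simp add: algebra_simps power2_eq_square power3_eq_cube power4_eq_xxxx)
  finally have Z: "0 \<le> 2 * (1 - \<tau>\<^sup>2) - d * (1 - 2 * \<tau>^3 + \<tau>^4)" .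
  have "0 \<le> \<nu>^3 * (\<tau>\<^sup>2 * (1 - d)\<^sup>2 + d * ((1 - d) * X + d * (X - Y))
      + (\<nu> - 2) * d * (2 * (1 - \<tau>\<^sup>2) - d * (1 - 2 * \<tau>^3 + \<tau>^4)))
      + \<nu>\<^sup>2 * (\<nu> - 2) * (1 - \<tau>) * (d * (2 - d))"
    by (intro add_nonneg_nonneg mult_nonneg_nonneg XY Z) (use assms \<tau> in auto)
  also have "\<dots> = \<nu> * t\<^sup>2 - 2 * t\<^sup>2 * d * (\<nu>\<^sup>2 + (\<nu> - t)) + (\<nu> + (\<nu> - t)) * t^3 * d\<^sup>2
    + (\<nu>\<^sup>2 - \<nu>) * (\<nu>\<^sup>2 + 2 * (\<nu> - t)) * (d * (2 - d))"
    unfolding \<tau>(1) X_def Y_def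
    by (simp add: algebra_simps power2_eq_square power3_eq_cube power4_eq_xxxx)
  finally show ?thesis .
qed

text \<open>With \<open>C = coth r\<close>, the left-hand side is the weight of \<open>u\<^sup>2\<close>.\<close>

lemma zero_order_nonpos:
  fixes \<nu> t r C K f :: real
  assumes \<nu>: "\<nu> \<ge> 2" and t: "t > 0" and r: "r > 0" and C1: "C \<ge> 1" and rC: "r * C \<ge> 1"
    and K: "K = max 0 (\<nu> - t)" and f: "f = t * r + K"
  shows "(K\<^sup>2 - \<nu>\<^sup>2) * f\<^sup>2 - (\<nu>\<^sup>2 - \<nu>) * (f\<^sup>2 + 2 * (C * f - t)) * (C\<^sup>2 - 1)
    + t * f * (2 * K * (\<nu> - 1) - 2 * \<nu> * C) + (\<nu>\<^sup>2 - \<nu>) * t\<^sup>2 + 2 * \<nu>\<^sup>2 * t + 2 * \<nu> * K * t * C \<le> 0"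
proof -
  have a: "\<nu>\<^sup>2 - \<nu> \<ge> 0" using \<nu> by (simp add: power2_eq_square)
  have I0: "C\<^sup>2 - 1 \<ge> 0" using C1 by simp
  \<comment> \<open>This bounds \<open>C\<^sup>2 - 1\<close> from below near the pole, where it has
    to absorb the positive terms.\<close>
  have "(r * C)\<^sup>2 \<ge> 1" using rC by simp
  then have I: "r\<^sup>2 * (C\<^sup>2 - 1) \<ge> 1 - r\<^sup>2" by (simp add: algebra_simps)
  have K0: "K \<ge> 0" using K by simp
  have "K \<le> K * C" using mult_left_mono[OF C1 K0] by simp
  moreover have "t * 1 \<le> t * (r * C)" using t rC by (intro mult_left_mono) auto
  ultimately have Cf: "C * f - t \<ge> K" unfolding f by (simp add: algebra_simps)
  show ?thesis
  proof (cases "t \<ge> \<nu>")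
    case True
    then have K: "K = 0" using K by simp
    \<comment> \<open>The positive term \<open>(\<nu>\<^sup>2 - \<nu>) * t\<^sup>2\<close> is
      absorbed by the terms with \<open>f\<^sup>2\<close>; the other one,
      \<open>2 * \<nu>\<^sup>2 * t\<close>, by the term linear in \<open>C\<close>, using
      \<open>\<nu> \<le> t * (r * C)\<close>.\<close>
    have 1: "(\<nu>\<^sup>2 - \<nu>) * t\<^sup>2 * (1 - r\<^sup>2 * (C\<^sup>2 - 1)) \<le> (\<nu>\<^sup>2 - \<nu>) * t\<^sup>2 * r\<^sup>2"
      using I a by (intro mult_left_mono) auto
    have 2: "(\<nu>\<^sup>2 - \<nu>) * t\<^sup>2 * r\<^sup>2 \<le> \<nu>\<^sup>2 * t\<^sup>2 * r\<^sup>2"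
      using \<nu> by (intro mult_right_mono) auto
    have 3: "(\<nu>\<^sup>2 - \<nu>) * (2 * (C * f - t)) * (C\<^sup>2 - 1) \<ge> 0"
      using a I0 Cf K0 by (intro mult_nonneg_nonneg) auto
    have "\<nu> * t * \<nu> \<le> \<nu> * t * (t * (r * C))"
    proof (rule mult_left_mono)
      show "\<nu> \<le> t * (r * C)" using True \<open>t * 1 \<le> t * (r * C)\<close> by simp
    qed (use \<nu> t in simp)
    then show ?thesis using 1 2 3 unfolding f K
      by (simp add: algebra_simps power2_eq_square)
  next
    case False
    then have K: "K = \<nu> - t" and t\<nu>: "t \<le> \<nu>" using K by auto
    \<comment> \<open>Expanding about \<open>r = 1\<close>, where \<open>f = \<nu>\<close>; beyond
      that point \<open>d\<close> is negative and every term of \<open>main\<close> has the right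
      sign.\<close>
    define d where "d = 1 - r"
    have fd: "f = \<nu> - t * d" unfolding f K d_def by (simp add: algebra_simps)
    define J where "J = (f\<^sup>2 + 2 * (C * f - t)) * (C\<^sup>2 - 1)"
    have J0: "J \<ge> 0" unfolding J_def using I0 Cf K0 by simp
    have rC': "2 * \<nu> * t\<^sup>2 * (r * C - 1) \<ge> 0" using rC \<nu> by simp
    have main: "0 \<le> \<nu> * t\<^sup>2 - 2 * t\<^sup>2 * d * (\<nu>\<^sup>2 + (\<nu> - t)) + (\<nu> + (\<nu> - t)) * t^3 * d\<^sup>2 + (\<nu>\<^sup>2 - \<nu>) * J"
    proof (cases "r \<le> 1")
      case True
      \<comment> \<open>From \<open>K \<ge> r * K\<close> and \<open>t + K = \<nu>\<close>. It makes
        the factor \<open>r\<^sup>2\<close> available that pairs with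
        \<open>C\<^sup>2 - 1\<close>.\<close>
      have "r * \<nu> \<le> f" unfolding f K using True r t\<nu> mult_right_mono[of r 1 "\<nu> - t"] by (simp add: algebra_simps)
      then have "(r * \<nu>)\<^sup>2 \<le> f\<^sup>2" using r \<nu> by (intro power_mono) auto
      moreover have "r\<^sup>2 * K \<le> C * f - t"
        using Cf K0 True r mult_right_mono[of "r\<^sup>2" 1 K] by (simp add: power_le_one)
      ultimately have "r\<^sup>2 * (\<nu>\<^sup>2 + 2 * K) \<le> f\<^sup>2 + 2 * (C * f - t)" by (simp add: algebra_simps)
      then have "(r\<^sup>2 * (\<nu>\<^sup>2 + 2 * K)) * (C\<^sup>2 - 1) \<le> J" unfolding J_def using I0 by (rule mult_right_mono)
      moreover have "(\<nu>\<^sup>2 + 2 * K) * (1 - r\<^sup>2) \<le> (\<nu>\<^sup>2 + 2 * K) * (r\<^sup>2 * (C\<^sup>2 - 1))"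
        using I K0 by (intro mult_left_mono) auto
      ultimately have "(\<nu>\<^sup>2 + 2 * K) * (d * (2 - d)) \<le> J"
        unfolding d_def by (simp add: algebra_simps power2_eq_square)
      then have "(\<nu>\<^sup>2 - \<nu>) * ((\<nu>\<^sup>2 + 2 * K) * (d * (2 - d))) \<le> (\<nu>\<^sup>2 - \<nu>) * J"
        using a by (rule mult_left_mono)
      then show ?thesis
        using quartic_nonneg[OF \<nu>, of t d] t t\<nu> True r unfolding K d_def by (simp add: mult.assoc)
    next
      case False
      then have "d \<le> 0" by (simp add: d_def)
      then have "2 * t\<^sup>2 * d * (\<nu>\<^sup>2 + (\<nu> - t)) \<le> 0"
        using t\<nu> by (intro mult_nonpos_nonneg mult_nonneg_nonpos) auto
      moreover have "(\<nu> + (\<nu> - t)) * t^3 * d\<^sup>2 \<ge> 0" "\<nu> * t\<^sup>2 \<ge> 0" "(\<nu>\<^sup>2 - \<nu>) * J \<ge> 0"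
        using t t\<nu> \<nu> a J0 by auto
      ultimately show ?thesis by linarith
    qed
    \<comment> \<open>As \<open>f - K = t * r\<close>, the terms linear in \<open>C\<close> outside
      \<open>J\<close> combine to \<open>- 2 * \<nu> * t\<^sup>2 * (r * C)\<close>.\<close>
    have "(K\<^sup>2 - \<nu>\<^sup>2) * f\<^sup>2 - (\<nu>\<^sup>2 - \<nu>) * J
    + t * f * (2 * K * (\<nu> - 1) - 2 * \<nu> * C) + (\<nu>\<^sup>2 - \<nu>) * t\<^sup>2 + 2 * \<nu>\<^sup>2 * t + 2 * \<nu> * K * t * C
     = - (\<nu> * t\<^sup>2 - 2 * t\<^sup>2 * d * (\<nu>\<^sup>2 + (\<nu> - t)) + (\<nu> + (\<nu> - t)) * t^3 * d\<^sup>2 + (\<nu>\<^sup>2 - \<nu>) * J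
       + 2 * \<nu> * t\<^sup>2 * (r * C - 1))"
      unfolding fd K d_def by (simp add: algebra_simps power2_eq_square power3_eq_cube)
    also have "\<dots> \<le> 0" using main rC' by linarith
    finally show ?thesis unfolding J_def by (simp only: mult.assoc)
  qed
qed

text \<open>The maximum of \<open>(2\<mu> + 1) t + \<nu>\<^sup>2 - \<mu>\<^sup>2\<close> over \<open>0 \<le> \<mu> \<le> \<nu>\<close>.\<close>

definition spectral_bound :: "real \<Rightarrow> real \<Rightarrow> real" where
  "spectral_bound \<nu> t = (if t \<ge> \<nu> then (2 * \<nu> + 1) * t else \<nu>\<^sup>2 + t + t\<^sup>2)"

context test_pole
begin

text \<open>The square method with the announced \<open>f\<close> and \<open>g\<close>. The function
  \<open>q\<close> is the derivative of \<open>g\<close> divided by \<open>sinh\<close>, and the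
  primed functions are the derivatives of the unprimed ones.\<close>

lemma weighted_inequality:
  assumes n: "n \<ge> 3" and t: "t > 0" and \<nu>: "\<nu> = (real n + 1) / 2"
  shows "0 \<le> (\<integral>x. conf x ^ (n+2) * ((lap x)\<^sup>2 + (t\<^sup>2 * (rad a x)\<^sup>2 - spectral_bound \<nu> t) * ((v x \<bullet> v x) / (conf x)\<^sup>2)) \<partial>lborel)"
proof -
  \<comment> \<open>This is \<open>\<nu> - \<mu>\<close> for \<open>\<mu> = min t \<nu>\<close>, the
    maximiser in \<open>spectral_bound \<nu> t\<close>.\<close>
  define K where "K = max 0 (\<nu> - t)"
  define f where "f r = t * r + K" for r
  define F where "F r = f r / sinh r" for r
  define F' where "F' r = (t * sinh r - f r * cosh r) / (sinh r)\<^sup>2" for r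
  define g where "g r = (\<nu> * (cosh r / sinh r) + K) * f r + \<nu> * t" for r
  define q where "q r = (- \<nu> * f r / (sinh r)\<^sup>2 + (\<nu> * (cosh r / sinh r) + K) * t) / sinh r" for r
  define q' where "q' r = (- 2 * \<nu> * t / (sinh r)\<^sup>2 + 2 * \<nu> * f r * cosh r / (sinh r)^3) / sinh r
     - (- \<nu> * f r / (sinh r)\<^sup>2 + (\<nu> * (cosh r / sinh r) + K) * t) * cosh r / (sinh r)\<^sup>2" for r
  have \<nu>2: "\<nu> \<ge> 2" using n unfolding \<nu> by simp
  have nn: "real n = 2 * \<nu> - 1" unfolding \<nu> by (simp add: field_simps)
  have cosh2: "(cosh r)\<^sup>2 = 1 + (sinh r)\<^sup>2" for r :: real by (simp add: cosh_square_eq)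
  show ?thesis
  proof (rule square_method[of F F' g q q'])
    fix r :: real assume r: "r > 0"
    then have s: "sinh r > 0" by simp
    have df: "(f has_real_derivative t) (at r)" unfolding f_def by (auto intro!: derivative_eq_intros)
    show "(F has_real_derivative F' r) (at r)"
      unfolding F_def F'_def using s
      by (auto intro!: derivative_eq_intros df simp: power2_eq_square)
    have dC: "((\<lambda>r. cosh r / sinh r) has_real_derivative - 1 / (sinh r)\<^sup>2) (at r)"
      by (rule derivative_eq_intros refl | (use s in simp; fail))+
        (use s cosh2[of r] in \<open>simp add: field_simps power2_eq_square\<close>)
    show "(g has_real_derivative q r * sinh r) (at r)"
      unfolding g_def[abs_def] by (rule derivative_eq_intros df dC refl)+ (use s in \<open>simp add: q_def\<close>)
    have "((\<lambda>r. - \<nu> * f r / (sinh r)\<^sup>2 + (\<nu> * (cosh r / sinh r) + K) * t) has_real_derivative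
        - 2 * \<nu> * t / (sinh r)\<^sup>2 + 2 * \<nu> * f r * cosh r / (sinh r)^3) (at r)"
      by (rule derivative_eq_intros df dC refl | (use s in simp; fail))+
        (use s in \<open>simp add: field_simps power2_eq_square power3_eq_cube\<close>)
    moreover have "(sinh has_real_derivative cosh r) (at r)" by (auto intro!: derivative_eq_intros)
    ultimately have "((\<lambda>r. (- \<nu> * f r / (sinh r)\<^sup>2 + (\<nu> * (cosh r / sinh r) + K) * t) / sinh r)
        has_real_derivative ((- 2 * \<nu> * t / (sinh r)\<^sup>2 + 2 * \<nu> * f r * cosh r / (sinh r)^3) * sinh r
        - (- \<nu> * f r / (sinh r)\<^sup>2 + (\<nu> * (cosh r / sinh r) + K) * t) * cosh r) / (sinh r * sinh r)) (at r)"
      by (rule DERIV_divide) (use s in simp)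
    then show "(q has_real_derivative q' r) (at r)"
      unfolding q_def[abs_def]
      by (rule DERIV_cong) (use s in \<open>simp add: q'_def diff_divide_distrib power2_eq_square\<close>)
    have ch: "cosh r \<ge> sinh r" by (simp add: sinh_le_cosh_real)
    define C where "C = cosh r / sinh r"
    have C1: "C \<ge> 1" using s ch by (simp add: C_def)
    have rC: "r * C \<ge> 1" using sinh_le_mult_cosh[of r] r s by (simp add: C_def)
    have K0: "K \<ge> 0" by (simp add: K_def)
    have "K \<le> K * C" using mult_left_mono[OF C1 K0] by simp
    moreover have "t * 1 \<le> t * (r * C)" using t rC by (intro mult_left_mono) auto
    ultimately have Cf: "C * f r \<ge> K + t" unfolding f_def by (simp add: algebra_simps)
    have Fs: "F r * sinh r = f r" "F r * cosh r = C * f r" "F' r * sinh r = t - C * f r"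
      using s by (simp_all add: F_def F'_def C_def field_simps power2_eq_square)
    have gC: "g r = (\<nu> * C + K) * f r + \<nu> * t" by (simp add: g_def C_def)
    have f0: "f r \<ge> K" using r t by (simp add: f_def)
    \<comment> \<open>One formula for both branches; in the radial condition its
      \<open>K\<^sup>2\<close> completes the square
      \<open>(f r - K)\<^sup>2 = t\<^sup>2 * r\<^sup>2\<close>, whence equality there.\<close>
    have B: "spectral_bound \<nu> t = K\<^sup>2 + 2 * \<nu> * t + t"
      by (auto simp: spectral_bound_def K_def max_def algebra_simps power2_eq_square)
    have "K * K \<le> K * f r" using f0 K0 by (rule mult_left_mono)
    then have Kf: "2 * t - 2 * (C * f r) - 2 * (K * f r) \<le> - K\<^sup>2"
      using Cf K0 zero_le_power2[of K] unfolding power2_eq_square by linarith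
    have "F' r * sinh r + real n * F r * cosh r - 2 * g r = t - 2 * (C * f r) - 2 * (K * f r) - 2 * \<nu> * t"
      unfolding mult.assoc Fs gC nn by (simp add: algebra_simps)
    also have "\<dots> \<le> t\<^sup>2 * r\<^sup>2 - spectral_bound \<nu> t"
      using Kf zero_le_power2[of "t * r"] unfolding B power_mult_distrib by linarith
    finally show "F' r * sinh r + real n * F r * cosh r - 2 * g r \<le> t\<^sup>2 * r\<^sup>2 - spectral_bound \<nu> t" .
    have "(F r)\<^sup>2 * (sinh r)\<^sup>2 - F' r * sinh r + real n * F r * cosh r - 2 * g r
        = (f r)\<^sup>2 - t - 2 * (K * f r) - 2 * \<nu> * t"
      unfolding power_mult_distrib[symmetric] mult.assoc Fs gC nn by (simp add: algebra_simps)
    also have "\<dots> = t\<^sup>2 * r\<^sup>2 - spectral_bound \<nu> t"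
      unfolding B f_def by (simp add: algebra_simps power2_eq_square)
    finally show "(F r)\<^sup>2 * (sinh r)\<^sup>2 - F' r * sinh r + real n * F r * cosh r - 2 * g r
      \<le> t\<^sup>2 * r\<^sup>2 - spectral_bound \<nu> t" by simp
    \<comment> \<open>With this all the weights become polynomials in \<open>C\<close>,
      \<open>f r\<close> and the constants, and \<open>p\<close> below is the derivative of
      \<open>g\<close>.\<close>
    have I: "1 / (sinh r)\<^sup>2 = C\<^sup>2 - 1"
      using s cosh2[of r] by (simp add: C_def power_divide field_simps)
    define p where "p = - \<nu> * f r * (C\<^sup>2 - 1) + (\<nu> * C + K) * t"
    have qs: "q r * sinh r = p" "q r * cosh r = C * p"
      unfolding q_def p_def I[symmetric] unfolding C_def using s by (simp_all add: field_simps)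
    have qs': "q' r * sinh r = (C\<^sup>2 - 1) * (2 * \<nu> * f r * C - 2 * \<nu> * t) - C * p"
      unfolding p_def I[symmetric] unfolding q'_def C_def using s
      by (simp add: field_simps power2_eq_square power3_eq_cube power4_eq_xxxx)
    have FF: "(q r * sinh r * F r + g r * F' r) * sinh r = p * f r + g r * (t - C * f r)"
    proof -
      have "(q r * sinh r * F r + g r * F' r) * sinh r = (q r * sinh r) * (F r * sinh r) + g r * (F' r * sinh r)"
        by (simp only: algebra_simps)
      then show ?thesis unfolding Fs qs .
    qed
    have "(g r)\<^sup>2 + q' r * sinh r + real (n+2) * q r * cosh r
      - (q r * sinh r * F r + g r * F' r) * sinh r - real (n+2) * (g r * F r) * cosh r
      = (K\<^sup>2 - \<nu>\<^sup>2) * (f r)\<^sup>2 - (\<nu>\<^sup>2 - \<nu>) * ((f r)\<^sup>2 + 2 * (C * f r - t)) * (C\<^sup>2 - 1)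
    + t * f r * (2 * K * (\<nu> - 1) - 2 * \<nu> * C) + (\<nu>\<^sup>2 - \<nu>) * t\<^sup>2 + 2 * \<nu>\<^sup>2 * t + 2 * \<nu> * K * t * C"
      unfolding FF unfolding mult.assoc Fs qs qs' of_nat_add nn gC p_def
      by (simp add: algebra_simps power2_eq_square)
    also have "\<dots> \<le> 0"
      by (rule zero_order_nonpos[OF \<nu>2 t r C1 rC K_def f_def])
    finally show "(g r)\<^sup>2 + q' r * sinh r + real (n+2) * q r * cosh r
      - (q r * sinh r * F r + g r * F' r) * sinh r - real (n+2) * (g r * F r) * cosh r \<le> 0" .
  next
    show "continuous_on {0<..} F'" "continuous_on {0<..} q'"
      unfolding F'_def q'_def f_def by (auto intro!: continuous_intros)
    show "continuous_on {0<..} (\<lambda>r. t\<^sup>2 * r\<^sup>2 - spectral_bound \<nu> t)"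
      by (auto intro!: continuous_intros)
  qed
qed

end

section \<open>The geodesic distance\<close>

context pole
begin

lemma coshd_ge_1: assumes "norm x < 1" shows "coshd a x \<ge> 1"
  using a1 x1[OF assms] by (simp add: coshd_def)

text \<open>The left-hand side is the derivative of \<open>arcosh (coshd a x + \<epsilon>)\<close>
  in direction \<open>h\<close>. Cauchy-Schwarz and the length of \<open>pvec a\<close> bound it,
  since adding \<open>\<epsilon>\<close> only enlarges the denominator.\<close>

lemma coshd_deriv_bound:
  assumes x: "norm x < 1" and \<epsilon>: "\<epsilon> > 0"
  shows "\<bar>(conf x)\<^sup>2 * (pvec a x \<bullet> h) / sqrt ((coshd a x + \<epsilon>)\<^sup>2 - 1)\<bar> \<le> conf x * norm h"
proof -
  have P: "coshd a x \<ge> 1" by (rule coshd_ge_1[OF x])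
  then have "(coshd a x)\<^sup>2 \<le> (coshd a x + \<epsilon>)\<^sup>2" "1 < (coshd a x + \<epsilon>)\<^sup>2"
    using \<epsilon> by (auto intro: power_mono simp: one_less_power)
  then have s: "sqrt ((coshd a x)\<^sup>2 - 1) \<le> sqrt ((coshd a x + \<epsilon>)\<^sup>2 - 1)" "0 < sqrt ((coshd a x + \<epsilon>)\<^sup>2 - 1)"
    by auto
  have "sqrt ((conf x)\<^sup>2 * (pvec a x \<bullet> pvec a x)) = conf x * norm (pvec a x)"
    using conf_pos[OF x] by (simp add: real_sqrt_mult norm_eq_sqrt_inner)
  then have n: "conf x * norm (pvec a x) = sqrt ((coshd a x)\<^sup>2 - 1)"
    using pvec_norm[OF x] by simp
  have "\<bar>(conf x)\<^sup>2 * (pvec a x \<bullet> h)\<bar> \<le> (conf x)\<^sup>2 * (norm (pvec a x) * norm h)"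
    unfolding abs_mult by (rule mult_mono) (auto simp: Cauchy_Schwarz_ineq2)
  also have "\<dots> = (conf x * norm (pvec a x)) * (conf x * norm h)"
    by (simp add: power2_eq_square)
  also have "\<dots> \<le> sqrt ((coshd a x + \<epsilon>)\<^sup>2 - 1) * (conf x * norm h)"
    unfolding n using s conf_pos[OF x] by (intro mult_right_mono) auto
  finally show ?thesis using s(2) by (simp add: abs_divide pos_divide_le_eq mult.commute)
qed

text \<open>\<^term>\<open>rad a\<close> is not differentiable at \<open>a\<close>; the function \<open>arcosh (coshd a y + \<epsilon>)\<close>
  is differentiable on the whole ball and still has Riemannian gradient of length at most 1.\<close>

lemma rad_le_length:
  assumes \<gamma>: "valid_path \<gamma>" "path_image \<gamma> \<subseteq> ball 0 1" "pathstart \<gamma> = x" "pathfinish \<gamma> = a"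
    and L: "((\<lambda>t. conf (\<gamma> t) * norm (vector_derivative \<gamma> (at t))) has_integral L) {0..1}"
  shows "rad a x \<le> L"
proof (rule field_le_epsilon)
  fix \<delta> :: real assume \<delta>: "\<delta> > 0"
  \<comment> \<open>Chosen so that the regularised distance takes the value \<open>\<delta>\<close>
    at the pole.\<close>
  define \<epsilon> where "\<epsilon> = cosh \<delta> - 1"
  have \<epsilon>: "\<epsilon> > 0" using cosh_real_strict_mono[of 0 \<delta>] \<delta> by (simp add: \<epsilon>_def)
  define \<phi> where "\<phi> y = arcosh (coshd a y + \<epsilon>)" for y
  define \<phi>' where "\<phi>' y h = (conf y)\<^sup>2 * (pvec a y \<bullet> h) / sqrt ((coshd a y + \<epsilon>)\<^sup>2 - 1)" for y h
  have in_ball: "norm (\<gamma> t) < 1" if "t \<in> {0..1}" for t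
    using \<gamma>(2) that by (force simp: path_image_def)
  have d\<phi>: "(\<phi> has_derivative \<phi>' y) (at y)" if y: "norm y < 1" for y
  proof -
    have P: "coshd a y + \<epsilon> > 1" using coshd_ge_1[OF y] \<epsilon> by simp
    have "(arcosh has_real_derivative 1 / sqrt ((coshd a y + \<epsilon>)\<^sup>2 - 1)) (at (coshd a y + \<epsilon>))"
      using arcosh_real_has_field_derivative[OF P, of UNIV] by simp
    moreover have "((\<lambda>y. coshd a y + \<epsilon>) has_derivative (\<lambda>h. (conf y)\<^sup>2 * (pvec a y \<bullet> h))) (at y)"
      using coshd_deriv[OF y] by (auto intro!: derivative_eq_intros)
    ultimately have "((\<lambda>y. arcosh (coshd a y + \<epsilon>)) has_derivative
        (\<lambda>h. 1 / sqrt ((coshd a y + \<epsilon>)\<^sup>2 - 1) * ((conf y)\<^sup>2 * (pvec a y \<bullet> h)))) (at y)"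
      unfolding has_field_derivative_def using has_derivative_compose by blast
    then show ?thesis by (simp add: \<phi>_def[abs_def] \<phi>'_def[abs_def])
  qed
  obtain E where E: "finite E" "\<gamma> C1_differentiable_on {0..1} - E" and c\<gamma>: "continuous_on {0..1} \<gamma>"
    using \<gamma>(1) by (auto simp: valid_path_def piecewise_C1_differentiable_on_def)
  define k where "k t = (if t \<in> E then 0 else \<phi>' (\<gamma> t) (vector_derivative \<gamma> (at t)))" for t
  \<comment> \<open>The exceptional points of the path are finitely many and the composition is
    continuous, so the fundamental theorem of calculus still applies.\<close>
  have "(k has_integral (\<phi> (\<gamma> 1) - \<phi> (\<gamma> 0))) {0..1}"
  proof (rule fundamental_theorem_of_calculus_interior_strong[OF E(1)])
    show "((\<lambda>t. \<phi> (\<gamma> t)) has_vector_derivative k t) (at t)" if t: "t \<in> {0<..<1} - E" for t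
    proof -
      have "(\<gamma> has_vector_derivative vector_derivative \<gamma> (at t)) (at t)"
        using E(2) t by (auto simp: C1_differentiable_on_eq vector_derivative_works)
      then have "((\<lambda>t. \<phi> (\<gamma> t)) has_derivative (\<lambda>s. \<phi>' (\<gamma> t) (s *\<^sub>R vector_derivative \<gamma> (at t)))) (at t)"
        unfolding has_vector_derivative_def
        by (rule has_derivative_compose) (use d\<phi> in_ball t in auto)
      moreover have "\<phi>' (\<gamma> t) (s *\<^sub>R h) = s * \<phi>' (\<gamma> t) h" for s h by (simp add: \<phi>'_def)
      ultimately show ?thesis using t by (simp add: has_vector_derivative_def k_def)
    qed
    show "continuous_on {0..1} (\<lambda>t. \<phi> (\<gamma> t))"
      by (rule continuous_on_compose2[OF has_derivative_imp_continuous_on[of "ball 0 1" \<phi> \<phi>'] c\<gamma>])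
         (use d\<phi> in_ball in auto)
  qed simp
  then have "((\<lambda>t. - k t) has_integral - (\<phi> (\<gamma> 1) - \<phi> (\<gamma> 0))) {0..1}" by (rule has_integral_neg)
  moreover have "- k t \<le> conf (\<gamma> t) * norm (vector_derivative \<gamma> (at t))" if "t \<in> {0..1}" for t
    using order_trans[OF abs_ge_minus_self coshd_deriv_bound[OF in_ball[OF that] \<epsilon>]] conf_pos[OF in_ball[OF that]]
    unfolding k_def \<phi>'_def by simp
  ultimately have "- (\<phi> (\<gamma> 1) - \<phi> (\<gamma> 0)) \<le> L" using L has_integral_le by blast
  moreover have "\<gamma> 0 = x" "\<gamma> 1 = a" using \<gamma>(3,4) by (auto simp: pathstart_def pathfinish_def)
  moreover have "\<phi> a = \<delta>" using \<delta> by (simp add: \<phi>_def coshd_def \<epsilon>_def arcosh_cosh_real)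
  moreover have "rad a x \<le> \<phi> x"
  proof -
    have "coshd a x \<ge> 1" using coshd_ge_1 in_ball[of 0] \<open>\<gamma> 0 = x\<close> by auto
    then show ?thesis using \<epsilon> unfolding rad_def \<phi>_def
      by (intro less_imp_le[OF arcosh_real_strict_mono]) auto
  qed
  ultimately show "rad a x \<le> L + \<delta>" by simp
qed

text \<open>The geodesic is the normalised plane section of the hyperboloid \<open>T\<^sup>2 - |V|\<^sup>2 = 1\<close>, projected
  stereographically to the ball by \<open>(T, V) \<mapsto> V / (1 + T)\<close>.\<close>

lemma geodesic_exists:
  assumes x: "norm x < 1"
  shows "\<exists>\<gamma>. valid_path \<gamma> \<and> path_image \<gamma> \<subseteq> ball 0 1 \<and> pathstart \<gamma> = x \<and> pathfinish \<gamma> = a \<and>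
    (\<forall>t\<in>{0..1}. conf (\<gamma> t) * norm (vector_derivative \<gamma> (at t)) = rad a x)"
proof (cases "x = a")
  case True
  \<comment> \<open>Treated apart because the general construction divides by
    \<open>sinh \<rho>\<close>.\<close>
  have "conf a * norm (vector_derivative (\<lambda>t. a) (at t)) = rad a x" for t
    using True by (simp add: rad_def coshd_def)
  moreover have "valid_path (\<lambda>t. a)"
    unfolding valid_path_def by (intro C1_differentiable_imp_piecewise) simp
  ultimately show ?thesis using True x
    by (intro exI[of _ "\<lambda>t. a"]) (auto simp: path_image_def pathstart_def pathfinish_def)
next
  case False
  then have x\<Omega>: "x \<in> \<Omega>" using x by (simp add: \<Omega>_def)
  define \<rho> where "\<rho> = rad a x"
  have \<rho>: "\<rho> > 0" "cosh \<rho> = coshd a x" using rad_pos[OF x\<Omega>] cosh_rad[OF x\<Omega>] by (auto simp: \<rho>_def)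
  have s: "sinh \<rho> > 0" using \<rho> by simp
  \<comment> \<open>The hyperbolic analogue of spherical linear interpolation: \<open>A\<close> runs
    from 1 to 0 and \<open>B\<close> from 0 to 1.\<close>
  define A B where "A t = sinh ((1 - t) * \<rho>) / sinh \<rho>" and "B t = sinh (t * \<rho>) / sinh \<rho>" for t
  define A' B' where "A' t = - \<rho> * cosh ((1 - t) * \<rho>) / sinh \<rho>" and "B' t = \<rho> * cosh (t * \<rho>) / sinh \<rho>" for t
  \<comment> \<open>\<open>(x0, xv)\<close> and \<open>(a0, av)\<close> are the points of the
    hyperboloid over \<open>x\<close> and \<open>a\<close>.\<close>
  define x0 a0 where "x0 = (1 + x \<bullet> x) / (1 - x \<bullet> x)" and "a0 = (1 + a \<bullet> a) / (1 - a \<bullet> a)"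
  define xv av where "xv = conf x *\<^sub>R x" and "av = conf a *\<^sub>R a"
  have lor: "x0\<^sup>2 - xv \<bullet> xv = 1" "a0\<^sup>2 - av \<bullet> av = 1" "x0 * a0 - xv \<bullet> av = cosh \<rho>"
    unfolding \<rho>(2) x0_def a0_def xv_def av_def conf_def coshd_def using a1 x1[OF x]
    by (simp_all add: divide_simps power2_eq_square) (simp_all add: algebra_simps inner_commute)
  have "x0 > 0" "a0 > 0" using a1 x1[OF x] by (auto simp: x0_def a0_def intro!: divide_pos_pos add_pos_nonneg)
  define T V where "T t = A t * x0 + B t * a0" and "V t = A t *\<^sub>R xv + B t *\<^sub>R av" for t
  define T' V' where "T' t = A' t * x0 + B' t * a0" and "V' t = A' t *\<^sub>R xv + B' t *\<^sub>R av" for t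
  define \<gamma> where "\<gamma> t = V t /\<^sub>R (1 + T t)" for t
  define \<gamma>' where "\<gamma>' t = V' t /\<^sub>R (1 + T t) - (T' t / (1 + T t)\<^sup>2) *\<^sub>R V t" for t
  have dA: "(A has_real_derivative A' t) (at t)" "(B has_real_derivative B' t) (at t)" for t
    unfolding A_def[abs_def] A'_def B_def[abs_def] B'_def using s
    by (auto intro!: derivative_eq_intros)
  \<comment> \<open>The Lorentz form on the plane spanned by the two lifted points; it reduces the
    next identities to addition theorems.\<close>
  have form: "(c * x0 + d * a0) * (c' * x0 + d' * a0) - (c *\<^sub>R xv + d *\<^sub>R av) \<bullet> (c' *\<^sub>R xv + d' *\<^sub>R av)
      = c * c' + d * d' + (c * d' + c' * d) * cosh \<rho>" for c d c' d'
  proof -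
    have "(c * x0 + d * a0) * (c' * x0 + d' * a0) - (c *\<^sub>R xv + d *\<^sub>R av) \<bullet> (c' *\<^sub>R xv + d' *\<^sub>R av)
      = c * c' * (x0\<^sup>2 - xv \<bullet> xv) + d * d' * (a0\<^sup>2 - av \<bullet> av) + (c * d' + c' * d) * (x0 * a0 - xv \<bullet> av)"
      by (simp add: algebra_simps power2_eq_square inner_commute)
    then show ?thesis unfolding lor by simp
  qed
  have add: "\<rho> = (1 - t) * \<rho> + t * \<rho>" for t by (simp add: algebra_simps)
  have csh: "cosh \<rho> = cosh ((1 - t) * \<rho>) * cosh (t * \<rho>) + sinh ((1 - t) * \<rho>) * sinh (t * \<rho>)"
    "sinh \<rho> = sinh ((1 - t) * \<rho>) * cosh (t * \<rho>) + cosh ((1 - t) * \<rho>) * sinh (t * \<rho>)" for t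
    using cosh_add[of "(1 - t) * \<rho>" "t * \<rho>"] sinh_add[of "(1 - t) * \<rho>" "t * \<rho>"] add[of t] by auto
  have hyp1: "T t * T t - V t \<bullet> V t = 1" for t
  proof -
    define p q where "p = sinh ((1 - t) * \<rho>)" and "q = sinh (t * \<rho>)"
    define p' q' where "p' = cosh ((1 - t) * \<rho>)" and "q' = cosh (t * \<rho>)"
    have c: "p'\<^sup>2 = 1 + p\<^sup>2" "q'\<^sup>2 = 1 + q\<^sup>2" by (simp_all add: p_def q_def p'_def q'_def cosh_square_eq)
    have "p\<^sup>2 + q\<^sup>2 + 2 * p * q * (p' * q' + p * q) = (p * q' + p' * q)\<^sup>2"
      using c by (simp add: power2_eq_square algebra_simps) (algebra)
    then have "p\<^sup>2 + q\<^sup>2 + 2 * p * q * cosh \<rho> = (sinh \<rho>)\<^sup>2"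
      using csh[of t] unfolding p_def q_def p'_def q'_def by metis
    then show ?thesis unfolding T_def V_def form A_def B_def using s
      by (simp add: p_def q_def field_simps power2_eq_square)
  qed
  \<comment> \<open>The lifted curve has constant speed \<open>\<rho>\<close>; the sign is that of a
    spacelike vector for the form \<open>T\<^sup>2 - |V|\<^sup>2\<close>.\<close>
  have hyp2: "T' t * T' t - V' t \<bullet> V' t = - (\<rho>\<^sup>2)" for t
  proof -
    define p q where "p = sinh ((1 - t) * \<rho>)" and "q = sinh (t * \<rho>)"
    define p' q' where "p' = cosh ((1 - t) * \<rho>)" and "q' = cosh (t * \<rho>)"
    have c: "p\<^sup>2 = p'\<^sup>2 - 1" "q\<^sup>2 = q'\<^sup>2 - 1" by (simp_all add: p_def q_def p'_def q'_def cosh_square_eq)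
    have "p'\<^sup>2 + q'\<^sup>2 - 2 * p' * q' * (p' * q' + p * q) = - ((p * q' + p' * q)\<^sup>2)"
      using c by (simp add: power2_eq_square algebra_simps) (algebra)
    then have *: "p'\<^sup>2 + q'\<^sup>2 - 2 * p' * q' * cosh \<rho> = - ((sinh \<rho>)\<^sup>2)"
      using csh[of t] unfolding p_def q_def p'_def q'_def by metis
    have "T' t * T' t - V' t \<bullet> V' t = \<rho>\<^sup>2 * (p'\<^sup>2 + q'\<^sup>2 - 2 * p' * q' * cosh \<rho>) / (sinh \<rho>)\<^sup>2"
      unfolding T'_def V'_def form A'_def B'_def using s
      by (simp add: p'_def q'_def field_simps power2_eq_square)
    then show ?thesis unfolding * using s by simp
  qed
  have dT: "(T has_real_derivative T' t) (at t)" for t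
    unfolding T_def[abs_def] T'_def by (auto intro!: derivative_eq_intros dA)
  have dV: "(V has_vector_derivative V' t) (at t)" for t
    unfolding V_def[abs_def] V'_def
    by (auto intro!: derivative_eq_intros dA[unfolded has_real_derivative_iff_has_vector_derivative]
       simp: has_real_derivative_iff_has_vector_derivative[symmetric] dA)
  \<comment> \<open>Differentiating the constant \<open>T t * T t - V t \<bullet> V t\<close> shows
    that position and velocity are Lorentz orthogonal.\<close>
  have hyp3: "T t * T' t - V t \<bullet> V' t = 0" for t
  proof -
    have "((\<lambda>t. T t * T t - V t \<bullet> V t) has_derivative
        (\<lambda>h. (T t * (T' t * h) + (T' t * h) * T t) - (V t \<bullet> (h *\<^sub>R V' t) + (h *\<^sub>R V' t) \<bullet> V t))) (at t)"
      by (intro has_derivative_diff has_derivative_mult has_derivative_inner)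
         (use dT[of t] dV[of t] in \<open>auto simp: has_field_derivative_def has_vector_derivative_def\<close>)
    moreover have "((\<lambda>t. T t * T t - V t \<bullet> V t) has_derivative (\<lambda>h. 0)) (at t)"
      unfolding hyp1 by simp
    ultimately have "(\<lambda>h. (T t * (T' t * h) + (T' t * h) * T t) - (V t \<bullet> (h *\<^sub>R V' t) + (h *\<^sub>R V' t) \<bullet> V t)) = (\<lambda>h. 0)"
      by (rule has_derivative_unique)
    from fun_cong[OF this, of 1] show ?thesis by (simp add: inner_commute[of "V' t"] mult.commute[of "T t"])
  qed
  have T0: "T t \<ge> 0" if "t \<in> {0..1}" for t
    unfolding T_def A_def B_def using that s \<rho> \<open>x0 > 0\<close> \<open>a0 > 0\<close> by auto
  have conf\<gamma>: "conf (\<gamma> t) = 1 + T t" "norm (\<gamma> t) < 1" if t: "t \<in> {0..1}" for t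
  proof -
    have V2: "V t \<bullet> V t = T t * T t - 1" using hyp1[of t] by simp
    define m where "m = 1 + T t"
    have m: "m > 0" "T t = m - 1" using T0[OF t] by (auto simp: m_def)
    have "\<gamma> t \<bullet> \<gamma> t = (T t * T t - 1) / (m * m)"
      unfolding \<gamma>_def m_def[symmetric] using V2 by (simp add: divide_simps)
    also have "\<dots> = (m - 2) / m" unfolding m(2) using m(1) by (simp add: field_simps)
    finally have "1 - \<gamma> t \<bullet> \<gamma> t = 2 / (1 + T t)"
      using m(1) unfolding m_def[symmetric] by (simp add: field_simps)
    moreover have "2 / (1 + T t) > 0" using T0[OF t] by simp
    ultimately have "\<gamma> t \<bullet> \<gamma> t < 1" "conf (\<gamma> t) = 1 + T t"
      by (linarith, simp add: conf_def)
    then show "conf (\<gamma> t) = 1 + T t" "norm (\<gamma> t) < 1" by (simp_all add: norm_eq_sqrt_inner)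
  qed
  have d\<gamma>: "(\<gamma> has_vector_derivative \<gamma>' t) (at t)" if t: "t \<in> {0..1}" for t
  proof -
    have "((\<lambda>t. inverse (1 + T t)) has_real_derivative - T' t / (1 + T t)\<^sup>2) (at t)"
      using T0[OF t] by (auto intro!: derivative_eq_intros dT simp: power2_eq_square divide_simps)
    from has_vector_derivative_scaleR[OF this dV] show ?thesis
      unfolding \<gamma>_def[abs_def] \<gamma>'_def by (simp add: add.commute)
  qed
  have c\<gamma>': "continuous_on {0..1} \<gamma>'"
  proof -
    have "continuous_on {0..1} T" "continuous_on {0..1} V"
      using has_derivative_imp_continuous_on[OF dT[unfolded has_field_derivative_def]]
        has_derivative_imp_continuous_on[OF dV[unfolded has_vector_derivative_def]] by auto
    moreover have "continuous_on {0..1} T'" "continuous_on {0..1} V'"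
      unfolding T'_def[abs_def] V'_def[abs_def] A'_def[abs_def] B'_def[abs_def] using s
      by (auto intro!: continuous_intros)
    moreover have "1 + T t \<noteq> 0" if "t \<in> {0..1}" for t using T0[OF that] by simp
    ultimately show ?thesis unfolding \<gamma>'_def[abs_def] by (intro continuous_intros) auto
  qed
  have "valid_path \<gamma>"
    unfolding valid_path_def
    by (rule C1_differentiable_imp_piecewise)
       (use d\<gamma> c\<gamma>' in \<open>auto simp: C1_differentiable_on_def intro!: exI[of _ \<gamma>']\<close>)
  moreover have "path_image \<gamma> \<subseteq> ball 0 1" using conf\<gamma>(2) by (auto simp: path_image_def)
  moreover have "pathstart \<gamma> = x"
  proof -
    have "1 + x0 = conf x" unfolding x0_def conf_def using x1[OF x] by (simp add: field_simps)
    then show ?thesis using s conf_pos[OF x]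
      by (simp add: pathstart_def \<gamma>_def V_def T_def A_def B_def xv_def)
  qed
  moreover have "pathfinish \<gamma> = a"
  proof -
    have "1 + a0 = conf a" unfolding a0_def conf_def using a1 by (simp add: field_simps)
    then show ?thesis using s conf_pos[OF pole]
      by (simp add: pathfinish_def \<gamma>_def V_def T_def A_def B_def av_def)
  qed
  moreover have "conf (\<gamma> t) * norm (vector_derivative \<gamma> (at t)) = rad a x" if t: "t \<in> {0..1}" for t
  proof -
    have T1: "1 + T t > 0" using T0[OF t] by simp
    \<comment> \<open>The velocity of the projected curve is \<open>w\<close> divided by
      \<open>1 + T t\<close>, which is \<open>conf (\<gamma> t)\<close>; so the hyperbolic speed is
      the Euclidean length of \<open>w\<close>, and the three Lorentz relations give it.\<close>
    define w where "w = V' t - (T' t / (1 + T t)) *\<^sub>R V t"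
    have "\<gamma>' t = w /\<^sub>R (1 + T t)"
      unfolding \<gamma>'_def w_def by (simp add: algebra_simps power2_eq_square divide_simps)
    then have "conf (\<gamma> t) * norm (vector_derivative \<gamma> (at t)) = norm w"
      using vector_derivative_at[OF d\<gamma>[OF t]] T1 unfolding conf\<gamma>(1)[OF t] by simp
    moreover have "w \<bullet> w = \<rho>\<^sup>2"
    proof -
      have e: "V t \<bullet> V t = T t * T t - 1" "V' t \<bullet> V' t = T' t * T' t + \<rho>\<^sup>2" "V t \<bullet> V' t = T t * T' t"
        "V' t \<bullet> V t = T t * T' t"
        using hyp1[of t] hyp2[of t] hyp3[of t] by (simp_all add: inner_commute)
      define m where "m = T' t / (1 + T t)"
      have m: "T' t = m * (1 + T t)" using T1 by (simp add: m_def)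
      have "w \<bullet> w = V' t \<bullet> V' t - m * (V t \<bullet> V' t + V' t \<bullet> V t) + m\<^sup>2 * (V t \<bullet> V t)"
        unfolding w_def m_def[symmetric] by (simp add: algebra_simps power2_eq_square)
      also have "\<dots> = \<rho>\<^sup>2" unfolding e m by (simp add: algebra_simps power2_eq_square)
      finally show ?thesis .
    qed
    ultimately show ?thesis using \<rho>(1) by (simp add: norm_eq_sqrt_inner \<rho>_def)
  qed
  ultimately show ?thesis by blast
qed

end

section \<open>The uncertainty principle\<close>

lemma sum_Basis_vec:
  fixes f :: "real ^ 'n::finite \<Rightarrow> 'b::comm_monoid_add"
  shows "(\<Sum>b\<in>Basis. f b) = (\<Sum>i\<in>UNIV. f (axis i 1))"
proof -
  have "(Basis :: (real ^ 'n) set) = range (\<lambda>i. axis i 1)" by (auto simp: Basis_vec_def)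
  moreover have "inj (\<lambda>i::'n. axis i (1::real))" by (auto simp: inj_on_def axis_eq_axis)
  ultimately show ?thesis using sum.reindex[of "\<lambda>i::'n. axis i (1::real)" UNIV f] by (simp add: o_def)
qed

lemma conf_norm: "conf x = 2 / (1 - (norm x)\<^sup>2)"
  by (simp add: conf_def dot_square_norm)

text \<open>The infimum is a minimum: no admissible curve is shorter than \<open>rad a x\<close>,
  and the explicit geodesic has exactly that length.\<close>

lemma hyp_dist_eq_rad:
  fixes a x :: "real ^ 'n::finite"
  assumes "norm a < 1" "norm x < 1"
  shows "hyp_dist x a = rad a x"
proof -
  interpret pole a by unfold_locales fact
  have speed: "sqrt (hyp_metric y w w) = conf y * norm w" if "norm y < 1" for y w :: "real ^ 'n"
    using conf_pos[OF that] unfolding hyp_metric_def conf_norm[symmetric]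
    by (simp add: real_sqrt_mult norm_eq_sqrt_inner)
  define X where "X = {L. \<exists>\<gamma>. valid_path \<gamma> \<and> path_image \<gamma> \<subseteq> hyp_space \<and> pathstart \<gamma> = x \<and> pathfinish \<gamma> = a \<and>
     ((\<lambda>t. sqrt (hyp_metric (\<gamma> t) (vector_derivative \<gamma> (at t)) (vector_derivative \<gamma> (at t)))) has_integral L) {0..1}}"
  have len: "((\<lambda>t. sqrt (hyp_metric (\<gamma> t) (vector_derivative \<gamma> (at t)) (vector_derivative \<gamma> (at t)))) has_integral L) {0..1}
      \<longleftrightarrow> ((\<lambda>t. conf (\<gamma> t) * norm (vector_derivative \<gamma> (at t))) has_integral L) {0..1}"
    if "path_image \<gamma> \<subseteq> ball 0 1" for \<gamma> :: "real \<Rightarrow> real ^ 'n" and L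
    by (rule has_integral_cong, rule speed) (use that in \<open>force simp: path_image_def\<close>)
  obtain \<gamma> where \<gamma>: "valid_path \<gamma>" "path_image \<gamma> \<subseteq> ball 0 1" "pathstart \<gamma> = x" "pathfinish \<gamma> = a"
    and c: "\<And>t. t \<in> {0..1} \<Longrightarrow> conf (\<gamma> t) * norm (vector_derivative \<gamma> (at t)) = rad a x"
    using geodesic_exists[OF assms(2)] by blast
  have "((\<lambda>t. conf (\<gamma> t) * norm (vector_derivative \<gamma> (at t))) has_integral rad a x) {0..1}"
    using has_integral_const_real[of "rad a x" 0 1] by (subst has_integral_cong[OF c]) auto
  then have "rad a x \<in> X" unfolding X_def hyp_space_def using \<gamma> len by blast
  moreover have "rad a x \<le> L" if "L \<in> X" for L
    using that rad_le_length len unfolding X_def hyp_space_def by blast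
  ultimately have "Inf X = rad a x" by (rule cInf_eq_minimum)
  then show ?thesis by (simp add: hyp_dist_def riem_dist_def X_def)
qed

text \<open>\<open>Ck_on\<close> speaks of directional derivatives only. Expanding in the standard
  basis assembles them into a gradient field and its derivative, which is self-adjoint because mixed
  derivatives commute.\<close>

lemma test_function_gradient:
  fixes u :: "'a::euclidean_space \<Rightarrow> real"
  assumes "Ck_on 2 UNIV u"
  obtains v H where "\<And>x. (u has_derivative (\<lambda>h. v x \<bullet> h)) (at x)"
    "\<And>x. (v has_derivative H x) (at x)" "\<And>e. continuous_on UNIV (\<lambda>x. H x e)"
    "\<And>x h k. H x h \<bullet> k = h \<bullet> H x k"
proof -
  define D where "D x h = frechet_derivative u (at x) h" for x h
  define D2 where "D2 e x h = frechet_derivative (\<lambda>y. D y e) (at x) h" for e x h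
  have du: "(u has_derivative D x) (at x)" for x
    using assms unfolding D_def by (simp add: numeral_2_eq_2 frechet_derivative_works[symmetric])
  have dD: "((\<lambda>y. D y e) has_derivative D2 e x) (at x)" for e x
    using assms unfolding D2_def D_def by (simp add: numeral_2_eq_2 frechet_derivative_works[symmetric])
  have c: "continuous_on UNIV (\<lambda>x. D2 e x f)" for e f
    using assms unfolding D2_def D_def by (simp add: numeral_2_eq_2)
  have sym: "D2 e x f = D2 f x e" for e x f
    by (rule second_derivative_symmetric[OF du dD c])
  define v where "v x = (\<Sum>b\<in>Basis. D x b *\<^sub>R b)" for x
  define H where "H x h = (\<Sum>b\<in>Basis. D2 b x h *\<^sub>R b)" for x h
  have Dv: "D x h = v x \<bullet> h" for x h
  proof -
    have "D x h = D x (\<Sum>b\<in>Basis. (h \<bullet> b) *\<^sub>R b)" by (simp add: euclidean_representation)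
    also have "\<dots> = (\<Sum>b\<in>Basis. (h \<bullet> b) * D x b)"
      using has_derivative_linear[OF du] by (simp add: linear_sum linear_cmul)
    finally show ?thesis unfolding v_def inner_sum_left inner_scaleR_left by (simp add: inner_commute mult.commute)
  qed
  have dv: "(v has_derivative H x) (at x)" for x
    unfolding v_def[abs_def] H_def[abs_def] by (intro derivative_intros dD)
  have Hk: "H x h \<bullet> k = D2 k x h" for x h k
  proof -
    have "((\<lambda>y. D y k) has_derivative (\<lambda>h. H x h \<bullet> k)) (at x)"
      unfolding Dv by (intro derivative_intros dv)
    then have "(\<lambda>h. H x h \<bullet> k) = D2 k x" by (rule has_derivative_unique[OF _ dD])
    then show ?thesis by metis
  qed
  show thesis
  proof (rule that)
    show "(u has_derivative (\<lambda>h. v x \<bullet> h)) (at x)" for x using du[of x] unfolding Dv .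
    show "continuous_on UNIV (\<lambda>x. H x e)" for e unfolding H_def by (intro continuous_intros c)
    show "H x h \<bullet> k = h \<bullet> H x k" for x h k using Hk sym by (metis inner_commute)
  qed (rule dv)
qed

locale hyp_test = test_pole a u v H S n
  for a :: "real ^ 'n::finite" and u v H S n
begin

lemma card_n: "CARD('n) = n + 2" using dim by simp

lemma riem_grad_eq:
  assumes "norm x < 1"
  shows "riem_grad hyp_metric u x = (1 / (conf x)\<^sup>2) *\<^sub>R v x"
proof -
  have D: "frechet_derivative u (at x) = (\<lambda>h. v x \<bullet> h)"
    using frechet_derivative_at[OF du] by metis
  have "(\<chi> i. frechet_derivative u (at x) (axis i 1)) = v x"
    unfolding D by (simp add: vec_eq_iff inner_axis)
  moreover have "((1 - (norm x)\<^sup>2) / 2)\<^sup>2 = 1 / (conf x)\<^sup>2"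
    by (simp add: conf_norm power_divide)
  ultimately show ?thesis
    using hyp_riem_grad[of x u] assms du by (auto simp: hyp_space_def differentiable_def)
qed

lemma hyp_grad_sq_eq:
  assumes "norm x < 1" shows "hyp_grad_sq u x = (v x \<bullet> v x) / (conf x)\<^sup>2"
  unfolding hyp_grad_sq_def riem_grad_eq[OF assms] hyp_metric_def conf_norm[symmetric]
  using conf_pos[OF assms] by (simp add: power2_eq_square)

lemma vol_density_eq: "norm (x :: real ^ 'n) < 1 \<Longrightarrow> vol_density hyp_metric x = conf x ^ (n + 2)"
  using hyp_vol_density[of x] card_n by (simp add: hyp_space_def conf_norm)

text \<open>In the ball the density times the Riemannian gradient is
  \<open>conf x ^ n *\<^sub>R v x\<close>; the product rule and division by the density give
  \<open>lap\<close>.\<close>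

lemma hyp_laplace_eq:
  assumes x: "norm x < 1" shows "hyp_laplace u x = lap x"
proof -
  have D: "frechet_derivative (\<lambda>y. vol_density hyp_metric y * riem_grad hyp_metric u y $ i) (at x)
      = (\<lambda>h. conf x ^ n * (H x h $ i) + (real n * conf x ^ (n + 1) * (x \<bullet> h)) * (v x $ i))" (is "_ = ?D") for i
  proof (rule frechet_derivative_at[symmetric])
    have "((\<lambda>y. v y $ i) has_derivative (\<lambda>h. H x h $ i)) (at x)"
      using bounded_linear.has_derivative[OF bounded_linear_vec_nth dv] .
    from has_derivative_mult[OF conf_power_deriv[OF x] this]
    show "((\<lambda>y. vol_density hyp_metric y * riem_grad hyp_metric u y $ i) has_derivative ?D) (at x)"
    proof (rule has_derivative_transform_within_open[of _ _ _ _ "ball 0 1"])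
      fix y :: "real ^ 'n" assume "y \<in> ball 0 1"
      then have y: "norm y < 1" by simp
      show "conf y ^ n * (v y $ i) = vol_density hyp_metric y * riem_grad hyp_metric u y $ i"
        unfolding vol_density_eq[OF y] riem_grad_eq[OF y] using conf_pos[OF y]
        by (simp add: power2_eq_square)
    qed (use x in auto)
  qed
  have "hyp_laplace u x = (\<Sum>i\<in>UNIV. conf x ^ n * (H x (axis i 1) $ i)
      + (real n * conf x ^ (n + 1) * (x $ i)) * (v x $ i)) / conf x ^ (n + 2)"
    unfolding hyp_laplace_def laplace_beltrami_def riem_div_def D vol_density_eq[OF x]
    by (simp add: inner_axis)
  also have "\<dots> = (conf x ^ n * (\<Sum>i\<in>UNIV. H x (axis i 1) $ i)
      + real n * conf x ^ (n + 1) * (x \<bullet> v x)) / conf x ^ (n + 2)"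
    by (simp add: sum.distrib sum_distrib_left inner_vec_def mult.assoc)
  also have "\<dots> = lap x"
    unfolding lap_def sum_Basis_vec using conf_pos[OF x]
    by (simp add: inner_axis add_divide_distrib power2_eq_square)
  finally show ?thesis .
qed

text \<open>\<open>f'\<close> is the intrinsic integrand and \<open>f\<close> its coordinate
  expression. They need to agree only in the ball, which carries the hyperbolic volume; as
  \<open>f\<close> vanishes off \<open>S\<close>, the integral extends to the whole space.\<close>

lemma integral_hyp_volume:
  assumes "continuous_on \<Omega> f" "\<And>x. x \<notin> S \<Longrightarrow> f x = 0" "\<And>x. norm x < 1 \<Longrightarrow> f' x = f x"
  shows "(\<integral>x. f' x \<partial>hyp_volume) = (\<integral>x. conf x ^ (n + 2) * f x \<partial>lborel)"
proof -
  let ?M = "restrict_space lborel (ball 0 1 :: (real ^ 'n) set)"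
  have sp: "space ?M = ball 0 1" by (simp add: space_restrict_space)
  have "continuous_on UNIV f"
    by (rule continuous_on_UNIV_zero_off[OF assms(1) open_Omega compact_imp_closed[OF S(1)] S(2) assms(2)])
  then have f: "f \<in> borel_measurable ?M"
    by (intro measurable_restrict_space1) (simp add: borel_measurable_continuous_onI)
  have m: "(\<lambda>x::real^'n. (2 / (1 - (norm x)\<^sup>2)) ^ (n + 2)) \<in> borel_measurable ?M"
    by (intro measurable_restrict_space1) measurable
  have "vol_density hyp_metric x = (2 / (1 - (norm x)\<^sup>2)) ^ (n + 2)" if "x \<in> space ?M" for x
    using vol_density_eq[of x] that unfolding sp conf_norm by simp
  from measurable_cong[THEN iffD2, OF this m]
  have g: "vol_density hyp_metric \<in> borel_measurable ?M" .
  have g0: "AE x in ?M. 0 \<le> vol_density hyp_metric x"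
    using conf_pos by (intro AE_I2) (auto simp: sp vol_density_eq less_imp_le)
  have "(\<integral>x. f' x \<partial>hyp_volume) = (\<integral>x. f x \<partial>hyp_volume)"
    by (rule Bochner_Integration.integral_cong)
       (auto simp: hyp_volume_def riem_volume_def hyp_space_def space_restrict_space assms(3))
  also have "\<dots> = (\<integral>x. vol_density hyp_metric x *\<^sub>R f x \<partial>?M)"
    unfolding hyp_volume_def riem_volume_def hyp_space_def by (rule integral_density[OF f g g0])
  also have "\<dots> = (\<integral>x. indicator (ball 0 1) x *\<^sub>R (vol_density hyp_metric x *\<^sub>R f x) \<partial>lborel)"
    by (rule integral_restrict_space) simp
  also have "\<dots> = (\<integral>x. conf x ^ (n + 2) * f x \<partial>lborel)"
  proof (rule Bochner_Integration.integral_cong)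
    fix x :: "real ^ 'n"
    show "indicator (ball 0 1) x *\<^sub>R (vol_density hyp_metric x *\<^sub>R f x) = conf x ^ (n + 2) * f x"
      using vol_density_eq[of x] assms(2)[of x] S(2) norm_Omega[of x] by (cases "norm x < 1") auto
  qed simp
  finally show ?thesis .
qed

end

text \<open>Since \<open>spectral_bound \<nu> t\<close> dominates \<open>2 * t * h + lam\<close>,
  the hypothesis yields \<open>(A - lam * D) - 2 * t * h * D + t\<^sup>2 * E \<ge> 0\<close> for all
  \<open>t > 0\<close>; its minimum over \<open>t\<close> is the claim.\<close>

lemma optimise_scale:
  fixes A D E \<nu> lam h :: real
  assumes E_t: "\<And>t. t > 0 \<Longrightarrow> 0 \<le> A + t\<^sup>2 * E - spectral_bound \<nu> t * D"
    and nonneg: "A \<ge> 0" "D \<ge> 0" "E \<ge> 0" and lam: "0 \<le> lam" "lam \<le> \<nu>\<^sup>2" and \<nu>: "\<nu> \<ge> 0"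
    and h: "h = (sqrt ((2 * \<nu>)\<^sup>2 - 4 * lam) + 1) / 2"
  shows "h\<^sup>2 * D\<^sup>2 \<le> (A - lam * D) * E"
proof -
  \<comment> \<open>In this parameter \<open>h = \<mu> + 1 / 2\<close> and
    \<open>lam = \<nu>\<^sup>2 - \<mu>\<^sup>2\<close>, so \<open>2 * t * h + lam\<close> is the
    expression whose maximum is the spectral bound.\<close>
  define \<mu> where "\<mu> = sqrt (\<nu>\<^sup>2 - lam)"
  have "(2 * \<nu>)\<^sup>2 - 4 * lam = 4 * (\<nu>\<^sup>2 - lam)" by (simp add: power_mult_distrib)
  then have h\<mu>: "2 * h = 2 * \<mu> + 1" unfolding h \<mu>_def by (simp only: real_sqrt_mult) simp
  have lam\<mu>: "lam = \<nu>\<^sup>2 - \<mu>\<^sup>2" using lam by (simp add: \<mu>_def)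
  have "\<mu>\<^sup>2 \<le> \<nu>\<^sup>2" using lam by (simp add: \<mu>_def)
  then have "\<mu> \<le> \<nu>" using \<nu> by (rule power2_le_imp_le)
  moreover have "0 \<le> \<mu>" using lam by (simp add: \<mu>_def)
  ultimately have \<mu>: "0 \<le> \<mu>" "\<mu> \<le> \<nu>" by auto
  have le: "2 * t * h + lam \<le> spectral_bound \<nu> t" for t
  proof (cases "t \<ge> \<nu>")
    case True
    have "0 \<le> (\<nu> - \<mu>) * (2 * t - \<nu> - \<mu>)" using \<mu> True by (intro mult_nonneg_nonneg) auto
    also have "\<dots> = (2 * \<nu> + 1) * t - (t * (2 * h) + lam)"
      unfolding h\<mu> lam\<mu> by (simp add: algebra_simps power2_eq_square)
    finally show ?thesis using True by (simp add: spectral_bound_def)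
  next
    case False
    have "0 \<le> (t - \<mu>)\<^sup>2" by simp
    also have "\<dots> = \<nu>\<^sup>2 + t + t\<^sup>2 - (t * (2 * h) + lam)"
      unfolding h\<mu> lam\<mu> by (simp add: algebra_simps power2_eq_square)
    finally show ?thesis using False by (simp add: spectral_bound_def)
  qed
  have main: "2 * t * h * D \<le> (A - lam * D) + t\<^sup>2 * E" if "t > 0" for t
    using E_t[OF that] mult_right_mono[OF le[of t] nonneg(2)] by (simp add: algebra_simps)
  have h0: "h > 0" using h\<mu> \<mu> by simp
  show ?thesis
  proof (cases "D = 0")
    case True then show ?thesis using nonneg by simp
  next
    case False
    then have D: "D > 0" using nonneg by simp
    show ?thesis
    proof (cases "E = 0")
      case True
      \<comment> \<open>Without the quadratic term the left-hand side of \<open>main\<close> grows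
        without bound; this \<open>t\<close> makes it exceed the right-hand side, a
        contradiction.\<close>
      define t where "t = (\<bar>A - lam * D\<bar> + 1) / (2 * h * D)"
      have "t > 0" using D h0 by (simp add: t_def)
      moreover have "2 * t * h * D = \<bar>A - lam * D\<bar> + 1" using D h0 by (simp add: t_def)
      ultimately show ?thesis using main[of t] True by simp
    next
      case False
      then have E: "E > 0" using nonneg by simp
      \<comment> \<open>The minimiser of the quadratic in \<open>t\<close>.\<close>
      have "2 * (h * D / E) * h * D \<le> (A - lam * D) + (h * D / E)\<^sup>2 * E"
        by (rule main) (use D h0 E in simp)
      then have "(2 * (h * D / E) * h * D) * E \<le> ((A - lam * D) + (h * D / E)\<^sup>2 * E) * E"
        using E by (intro mult_right_mono) auto
      then show ?thesis using E by (simp add: power2_eq_square algebra_simps)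
    qed
  qed
qed

text \<open>All three integrals become Lebesgue integrals of \<open>lap\<close>, \<open>rad\<close>
  and the squared gradient \<open>G\<close>. The weighted inequality, split by linearity, then
  supplies the hypothesis for optimising the scale.\<close>

lemma hyp_uncertainty:
  fixes x0 :: "real ^ 'n::finite"
  assumes N: "CARD('n) \<ge> 5" and x0: "x0 \<in> hyp_space" and lam: "0 \<le> lam" "lam \<le> ((real CARD('n) - 1) / 2)\<^sup>2"
    and u: "u \<in> test_functions (hyp_space - {x0})"
  shows "(h_const CARD('n) lam)\<^sup>2 * (\<integral>x. hyp_grad_sq u x \<partial>hyp_volume)\<^sup>2
    \<le> (\<integral>x. (hyp_laplace u x)\<^sup>2 - lam * hyp_grad_sq u x \<partial>hyp_volume)
      * (\<integral>x. (hyp_dist x x0)\<^sup>2 * hyp_grad_sq u x \<partial>hyp_volume)"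
proof -
  have px: "norm x0 < 1" using x0 by (simp add: hyp_space_def)
  obtain v H where vH: "\<And>x. (u has_derivative (\<lambda>h. v x \<bullet> h)) (at x)"
    "\<And>x. (v has_derivative H x) (at x)" "\<And>e. continuous_on UNIV (\<lambda>x. H x e)"
    "\<And>x h k. H x h \<bullet> k = h \<bullet> H x k"
    using test_function_gradient[of u] u by (auto simp: test_functions_def)
  have pole: "pole x0" by unfold_locales (rule px)
  define S where "S = closure {x. u x \<noteq> 0}"
  have S: "compact S" "S \<subseteq> pole.\<Omega> x0" "\<And>x. x \<notin> S \<Longrightarrow> u x = 0"
    using u closure_subset[of "{x. u x \<noteq> 0}"] by (auto simp: S_def test_functions_def pole.\<Omega>_def[OF pole] hyp_space_def)
  define n where "n = CARD('n) - 2"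
  interpret hyp_test x0 u v H S n
    by unfold_locales (use px vH S N in \<open>auto simp: n_def\<close>)
  define \<nu> where "\<nu> = (real n + 1) / 2"
  have n: "n \<ge> 3" "real CARD('n) - 1 = 2 * \<nu>" using N by (auto simp: n_def \<nu>_def)
  define G where "G x = (v x \<bullet> v x) / (conf x)\<^sup>2" for x
  have Gc: "continuous_on \<Omega> G"
    unfolding G_def[abs_def] by (intro continuous_intros continuous_Omega cont_uvH ballI) (simp add: conf_ne)
  have z: "G x = 0" "lap x = 0" if "x \<notin> S" for x
    using that by (simp_all add: G_def lap_def zero_off)
  note c = continuous_Omega continuous_lap Gc
  define A D E where "A = (\<integral>x. conf x ^ (n+2) * (lap x)\<^sup>2 \<partial>lborel)"
    and "D = (\<integral>x. conf x ^ (n+2) * G x \<partial>lborel)" and "E = (\<integral>x. conf x ^ (n+2) * ((rad x0 x)\<^sup>2 * G x) \<partial>lborel)"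
  have i: "integrable lborel (\<lambda>x. conf x ^ (n+2) * (lap x)\<^sup>2)" "integrable lborel (\<lambda>x. conf x ^ (n+2) * G x)"
    "integrable lborel (\<lambda>x. conf x ^ (n+2) * ((rad x0 x)\<^sup>2 * G x))"
    by (rule integrable_Omega, intro continuous_intros c, simp add: z)+
  have hg: "hyp_grad_sq u x = G x" if "norm x < 1" for x
    using hyp_grad_sq_eq[OF that] by (simp add: G_def)
  have G0: "G x \<ge> 0" for x by (simp add: G_def)
  \<comment> \<open>Outside the ball \<open>conf\<close> may be negative, hence the vanishing off
    \<open>S\<close> is part of the condition.\<close>
  have pos: "0 \<le> conf x ^ (n+2) * r" if "r \<ge> 0" "x \<notin> S \<Longrightarrow> r = 0" for x r
    using that conf_pos[OF norm_Omega, of x] S(2)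
    by (cases "x \<in> S") (auto simp: less_imp_le)
  have nonneg: "A \<ge> 0" "D \<ge> 0" "E \<ge> 0"
    unfolding A_def D_def E_def by (intro Bochner_Integration.integral_nonneg pos; simp add: z G0)+
  have Et: "0 \<le> A + t\<^sup>2 * E - spectral_bound \<nu> t * D" if t: "t > 0" for t
  proof -
    have "0 \<le> (\<integral>x. conf x ^ (n+2) * ((lap x)\<^sup>2 + (t\<^sup>2 * (rad x0 x)\<^sup>2 - spectral_bound \<nu> t) * G x) \<partial>lborel)"
      using weighted_inequality[OF n(1) t \<nu>_def] unfolding G_def .
    also have "\<dots> = (\<integral>x. conf x ^ (n+2) * (lap x)\<^sup>2 + t\<^sup>2 * (conf x ^ (n+2) * ((rad x0 x)\<^sup>2 * G x))
        - spectral_bound \<nu> t * (conf x ^ (n+2) * G x) \<partial>lborel)"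
      by (rule Bochner_Integration.integral_cong) (simp_all add: algebra_simps)
    also have "\<dots> = A + t\<^sup>2 * E - spectral_bound \<nu> t * D"
      using i unfolding A_def D_def E_def by simp
    finally show ?thesis .
  qed
  have "(\<integral>x. hyp_grad_sq u x \<partial>hyp_volume) = D"
    unfolding D_def by (rule integral_hyp_volume[OF Gc z(1)]) (assumption, rule hg)
  moreover have "(\<integral>x. (hyp_dist x x0)\<^sup>2 * hyp_grad_sq u x \<partial>hyp_volume) = E"
    unfolding E_def by (rule integral_hyp_volume)
      (intro continuous_intros c, simp_all add: z hg hyp_dist_eq_rad[OF px])
  moreover have "(\<integral>x. (hyp_laplace u x)\<^sup>2 - lam * hyp_grad_sq u x \<partial>hyp_volume) = A - lam * D"
  proof -
    have "(\<integral>x. (hyp_laplace u x)\<^sup>2 - lam * hyp_grad_sq u x \<partial>hyp_volume)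
        = (\<integral>x. conf x ^ (n+2) * ((lap x)\<^sup>2 - lam * G x) \<partial>lborel)"
      by (rule integral_hyp_volume)
        (intro continuous_intros c, simp_all add: z hg hyp_laplace_eq)
    also have "\<dots> = (\<integral>x. conf x ^ (n+2) * (lap x)\<^sup>2 - lam * (conf x ^ (n+2) * G x) \<partial>lborel)"
      by (rule Bochner_Integration.integral_cong) (simp_all add: algebra_simps)
    also have "\<dots> = A - lam * D" using i unfolding A_def D_def by simp
    finally show ?thesis .
  qed
  moreover have "(h_const CARD('n) lam)\<^sup>2 * D\<^sup>2 \<le> (A - lam * D) * E"
  proof (rule optimise_scale[OF Et nonneg lam(1)])
    show "lam \<le> \<nu>\<^sup>2" using lam(2) unfolding n(2) by simp
    show "h_const CARD('n) lam = (sqrt ((2 * \<nu>)\<^sup>2 - 4 * lam) + 1) / 2" unfolding h_const_def n(2) ..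
  qed (simp_all add: \<nu>_def)
  ultimately show ?thesis by simp
qed

theorem theorem2p3:
  fixes x0 :: "real ^ 'n::finite"
  assumes "CARD('n) \<ge> 5" and "x0 \<in> hyp_space"
  shows "(\<forall>lam u. 0 \<le> lam \<and> lam \<le> ((real CARD('n) - 1) / 2)\<^sup>2 \<and> u \<in> test_functions (hyp_space - {x0}) \<longrightarrow>
            (\<integral>x. (hyp_laplace u x)\<^sup>2 - lam * hyp_grad_sq u x \<partial>hyp_volume)
              * (\<integral>x. (hyp_dist x x0)\<^sup>2 * hyp_grad_sq u x \<partial>hyp_volume)
            \<ge> (h_const CARD('n) lam)\<^sup>2 * (\<integral>x. hyp_grad_sq u x \<partial>hyp_volume)\<^sup>2)
       \<and> (\<forall>u \<in> test_functions (hyp_space - {x0}).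
            (\<integral>x. (hyp_laplace u x)\<^sup>2 \<partial>hyp_volume)
              * (\<integral>x. (hyp_dist x x0)\<^sup>2 * hyp_grad_sq u x \<partial>hyp_volume)
            \<ge> (real CARD('n))\<^sup>2 / 4 * (\<integral>x. hyp_grad_sq u x \<partial>hyp_volume)\<^sup>2)"
proof (intro conjI allI ballI impI)
  fix u :: "real ^ 'n \<Rightarrow> real" assume u: "u \<in> test_functions (hyp_space - {x0})"
  have "(h_const CARD('n) 0)\<^sup>2 = (real CARD('n))\<^sup>2 / 4"
    using assms(1) by (simp add: h_const_def power_divide)
  then show "(\<integral>x. (hyp_laplace u x)\<^sup>2 \<partial>hyp_volume)
              * (\<integral>x. (hyp_dist x x0)\<^sup>2 * hyp_grad_sq u x \<partial>hyp_volume)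
            \<ge> (real CARD('n))\<^sup>2 / 4 * (\<integral>x. hyp_grad_sq u x \<partial>hyp_volume)\<^sup>2"
    using hyp_uncertainty[OF assms _ _ u, of 0] unfolding \<open>(h_const CARD('n) 0)\<^sup>2 = _\<close> by simp
qed (use hyp_uncertainty[OF assms] in blast)

end
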